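(* Let $n,m\ge 1$ be integers and let $\Sigma_0\in\mathbb{R}^{n\times n}$ be a symmetric positive definite matrix with $n$ distinct (positive) eigenvalues. Let $\Sigma_0=\Omega\Lambda\Omega^\top$ be a spectral decomposition of $\Sigma_0$, with $\Omega\in\mathbb{R}^{n\times n}$ orthogonal and $\Lambda=\mathrm{Diag}(\lambda_1,\dots,\lambda_n)$, eigenvalues ordered decreasingly. Let $k\in\{1,\dots,\min\{n,m\}\}$. Then a matrix $W^*\in\mathcal{M}(k)$ is a critical point of the restriction $L^1|_{\mathcal{M}(k)}$ if and only if $$W^*=\Omega_{\mathcal{J}_k}\bar\Lambda_{\mathcal{J}_k}^{1/2}V^\top$$ for some $\mathcal{J}_k\subseteq\{1,\dots,n\}$ with $|\mathcal{J}_k|=k$ and some $V\in\mathbb{R}^{m\times k}$ with $V^\top V=I_k$. The minimum of $L^1$ over $\mathcal{M}(\leqslant k)$ is attained precisely at those points for which $\mathcal{J}_k=\{1,\dots,k\}$. In particular, $\inf_{\mathcal{M}(k)}L^1=\min_{\mathcal{M}(k)}L^1$ and $\min_{\mathcal{M}(k)}L^1=\min_{\mathcal{M}(\leqslant k)}L^1$.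
   Context: The loss is $L^1:\mathbb{R}^{n\times m}\to\mathbb{R}$, $L^1(W)=\operatorname{tr}\big(WW^\top+\Sigma_0-2(\Sigma_0^{1/2}WW^\top\Sigma_0^{1/2})^{1/2}\big)$ (the squared Bures-Wasserstein distance between $WW^\top$ and $\Sigma_0$). $\mathcal{M}(k)$ is the set of real $n\times m$ matrices of rank exactly $k$, a smooth embedded submanifold of $\mathbb{R}^{n\times m}$; $\mathcal{M}(\leqslant k)$ is the set of $n\times m$ matrices of rank at most $k$. For a function $f$ on $\mathbb{R}^{n\times m}$ whose restriction to a smooth manifold $\mathcal{M}$ is differentiable, $W\in\mathcal{M}$ is a critical point of $f|_{\mathcal{M}}$ if the differential of $f|_{\mathcal{M}}$ at $W$ is zero (the restriction of $L^1$ to $\mathcal{M}(k)$ is differentiable). For an index set $\mathcal{J}_k\subseteq\{1,\dots,n\}$ with $k$ elements, $\Omega_{\mathcal{J}_k}\in\mathbb{R}^{n\times k}$ is the submatrix of columns of $\Omega$ with index in $\mathcal{J}_k$, and $\bar\Lambda_{\mathcal{J}_k}\in\mathbb{R}^{k\times k}$ is the diagonal submatrix of $\Lambda$ with rows and columns indexed by $\mathcal{J}_k$. *)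

theory Defs
  imports "HOL-Analysis.Analysis"
begin

text \<open>
  A real matrix with n rows and m columns has type \<open>real ^ 'm ^ 'n\<close>, whose norm is the Frobenius norm.
  Index types whose order matters (the ordering of the eigenvalues, the columns of a submatrix)
  are finite and linearly ordered.
\<close>

definition pos_def :: "real ^ 'n ^ 'n \<Rightarrow> bool" where
  "pos_def A \<longleftrightarrow> transpose A = A \<and> (\<forall>x. x \<noteq> 0 \<longrightarrow> x \<bullet> (A *v x) > 0)"

definition pos_semidef :: "real ^ 'n ^ 'n \<Rightarrow> bool" where
  "pos_semidef A \<longleftrightarrow> transpose A = A \<and> (\<forall>x. x \<bullet> (A *v x) \<ge> 0)"

definition eigenvalues :: "real ^ 'n ^ 'n \<Rightarrow> real set" where
  "eigenvalues A = {c. \<exists>x. x \<noteq> 0 \<and> A *v x = c *\<^sub>R x}"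

definition Diag :: "('n \<Rightarrow> real) \<Rightarrow> real ^ 'n ^ 'n" where
  "Diag d = (\<chi> i j. if i = j then d i else 0)"

text \<open>The symmetric positive semidefinite square root; only meaningful for positive semidefinite
  arguments, for which it exists and is unique.\<close>

definition psd_sqrt :: "real ^ 'n ^ 'n \<Rightarrow> real ^ 'n ^ 'n" where
  "psd_sqrt A = (THE B. pos_semidef B \<and> B ** B = A)"

definition bw_loss :: "real ^ 'n ^ 'n \<Rightarrow> real ^ 'm ^ 'n \<Rightarrow> real" where
  "bw_loss \<Sigma> W = trace (W ** transpose W + \<Sigma>
      - 2 *\<^sub>R psd_sqrt (psd_sqrt \<Sigma> ** W ** transpose W ** psd_sqrt \<Sigma>))"

definition rank_eq :: "nat \<Rightarrow> (real ^ 'm ^ 'n) set" where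
  "rank_eq k = {W. rank W = k}"

definition rank_le :: "nat \<Rightarrow> (real ^ 'm ^ 'n) set" where
  "rank_le k = {W. rank W \<le> k}"

text \<open>Tangent vectors are the velocities at \<open>0\<close> of the \<open>C\<^sup>\<infinity>\<close> curves in \<open>M\<close> through \<open>W\<close>;
  \<open>G i\<close> is the \<open>i\<close>-th derivative of the curve \<open>G 0\<close>.\<close>

definition tangent_vectors :: "'a::real_normed_vector set \<Rightarrow> 'a \<Rightarrow> 'a set" where
  "tangent_vectors M W = {v. \<exists>(G :: nat \<Rightarrow> real \<Rightarrow> 'a) e. e > 0 \<and>
      (\<forall>i. \<forall>t\<in>{-e<..<e}. (G i has_vector_derivative G (Suc i) t) (at t)) \<and>
      (\<forall>t\<in>{-e<..<e}. G 0 t \<in> M) \<and> G 0 0 = W \<and> G 1 0 = v}"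

text \<open>
  For an embedded submanifold \<open>M\<close>, the restriction of \<open>f\<close> to \<open>M\<close> is differentiable at \<open>W\<close> iff
  \<open>f\<close> has some derivative \<open>D\<close> at \<open>W\<close> within \<open>M\<close>. Such a \<open>D\<close> is determined only on the tangent space,
  and its restriction to the tangent space is the differential of the restriction of \<open>f\<close> to \<open>M\<close>.
\<close>

definition critical_point_on :: "('a::real_normed_vector \<Rightarrow> real) \<Rightarrow> 'a set \<Rightarrow> 'a \<Rightarrow> bool" where
  "critical_point_on f M W \<longleftrightarrow> W \<in> M \<and>
     (\<exists>D. (f has_derivative D) (at W within M) \<and> (\<forall>v\<in>tangent_vectors M W. D v = 0))"

text \<open>The element of \<open>J\<close> at the (zero-based) position of \<open>a\<close> in its index type. When \<open>card J = CARD('k)\<close>,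
  this is the increasing enumeration of \<open>J\<close>; otherwise it is meaningless.\<close>

definition nth_index :: "'n::{finite,linorder} set \<Rightarrow> 'k::{finite,linorder} \<Rightarrow> 'n" where
  "nth_index J a = sorted_list_of_set J ! card {b. b < a}"

definition col_submatrix ::
  "real ^ 'n::{finite,linorder} ^ 'm \<Rightarrow> 'n set \<Rightarrow> real ^ 'k::{finite,linorder} ^ 'm" where
  "col_submatrix A J = (\<chi> i a. A $ i $ nth_index J a)"

definition principal_submatrix ::
  "real ^ 'n::{finite,linorder} ^ 'n::{finite,linorder} \<Rightarrow> 'n set \<Rightarrow> real ^ 'k::{finite,linorder} ^ 'k::{finite,linorder}" where
  "principal_submatrix A J = (\<chi> a b. A $ nth_index J a $ nth_index J b)"

text \<open>The counterpart of \<open>{1,\<dots>,k}\<close>: the \<open>k\<close> smallest indices.\<close>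

definition first_indices :: "nat \<Rightarrow> 'n::{finite,linorder} set" where
  "first_indices k = {i. card {j. j < i} < k}"

end

theory Submission
  imports Defs
begin

text \<open>
  Write \<open>S = \<Sigma>\<^sup>1\<^sup>/\<^sup>2\<close>. The trace of \<open>(S W W\<^sup>T S)\<^sup>1\<^sup>/\<^sup>2\<close> is the nuclear norm of \<open>S W\<close>, so for every contraction
  \<open>Q\<close> the loss is at most the quadratic \<open>\<parallel>W - S Q\<parallel>\<^sup>2 + tr \<Sigma> - \<parallel>S Q\<parallel>\<^sup>2\<close>, with equality when \<open>Q\<close> is the polar
  factor of \<open>S W\<close>.

  If \<open>W\<close> is critical, this quadratic touches the loss from above along the curves \<open>(1 + t A) W\<close>, hence
  \<open>(W - S Q) W\<^sup>T = 0\<close>. With \<open>P = (S W W\<^sup>T S)\<^sup>1\<^sup>/\<^sup>2\<close> this reads \<open>W W\<^sup>T S = S P\<close>; taking transposes, \<open>P\<close> commutes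
  with \<open>\<Sigma>\<close>, so \<open>W W\<^sup>T = P\<close> and \<open>P\<^sup>2 = \<Sigma> P\<close>, and \<open>P\<close> is diagonal in the eigenbasis of \<open>\<Sigma>\<close> because the
  eigenvalues are distinct.

  Conversely, near a point \<open>U \<Lambda>\<^sup>1\<^sup>/\<^sup>2 V\<^sup>T\<close> of the asserted form the loss on matrices of rank \<open>k\<close> deviates only
  quadratically from its value there: from above by the quadratic for \<open>Q = U V\<^sup>T\<close>, from below because the
  nuclear norm of \<open>A B\<^sup>T\<close> is at most \<open>(\<parallel>A\<parallel>\<^sup>2 + \<parallel>B\<parallel>\<^sup>2) / 2\<close>, applied to an explicit factorization of \<open>S W'\<close>.

  For the minimum, \<open>\<parallel>S Q\<parallel>\<^sup>2 = tr (\<Sigma> Q Q\<^sup>T)\<close> with \<open>Q Q\<^sup>T\<close> a projection of rank at most \<open>k\<close>, and Ky Fan's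
  inequality, with its equality case, applies.
\<close>

section \<open>Spectral theorem for symmetric matrices\<close>

text \<open>The quadratic form \<open>x \<bullet> f x\<close> attains its maximum \<open>c\<close>
  on the compact unit sphere of \<open>V\<close>. At a maximizer \<open>u\<close> the residual
  \<open>w = f u - c *\<^sub>R u\<close> must vanish, since moving from \<open>u\<close> along
  \<open>w\<close> would otherwise raise the Rayleigh quotient to first order.\<close>

lemma self_adjoint_eigenvector_exists:
  fixes f :: "'a::euclidean_space \<Rightarrow> 'a"
  assumes f: "linear f" and sa: "\<And>x y. f x \<bullet> y = x \<bullet> f y"
    and V: "subspace V" "f ` V \<subseteq> V" "V \<noteq> {0}"
  obtains u c where "u \<in> V" "norm u = 1" "f u = c *\<^sub>R u"
proof -
  interpret f: linear f by (rule f)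
  obtain v where v: "v \<in> V" "v \<noteq> 0" using V subspace_0 by blast
  let ?K = "V \<inter> sphere 0 1"
  have "v /\<^sub>R norm v \<in> ?K" using v V by (auto simp: subspace_scale)
  then have "?K \<noteq> {}" by blast
  moreover have "compact ?K" using closed_subspace[OF V(1)] by (simp add: closed_Int_compact)
  moreover have "continuous_on ?K (\<lambda>x. x \<bullet> f x)"
    using f by (intro continuous_intros linear_continuous_on) (simp add: linear_conv_bounded_linear)
  ultimately have "\<exists>u\<in>?K. \<forall>y\<in>?K. y \<bullet> f y \<le> u \<bullet> f u"
    by (intro continuous_attains_sup)
  then obtain u where u: "u \<in> ?K" and max: "\<And>y. y \<in> ?K \<Longrightarrow> y \<bullet> f y \<le> u \<bullet> f u"
    by blast
  define c where "c = u \<bullet> f u"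
  have uV: "u \<in> V" and uu: "u \<bullet> u = 1" using u by (auto simp: norm_eq_1)
  have le: "x \<bullet> f x \<le> c * (x \<bullet> x)" if "x \<in> V" for x
  proof (cases "x = 0")
    case False
    then have "x /\<^sub>R norm x \<in> ?K" using that V by (auto simp: subspace_scale)
    from max[OF this] have "(x \<bullet> f x) / (norm x)\<^sup>2 \<le> c"
      by (simp add: f.scaleR c_def power2_eq_square divide_inverse mult_ac)
    then show ?thesis using False by (simp add: divide_simps power2_norm_eq_inner)
  qed simp
  define w where "w = f u - c *\<^sub>R u"
  have wV: "w \<in> V" unfolding w_def using uV V by (auto intro!: subspace_diff subspace_scale)
  define a b where "a = w \<bullet> w" and "b = c * a - w \<bullet> f w"
  have b0: "b \<ge> 0" using le[OF wV] by (simp add: a_def b_def)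
  \<comment> \<open>This is \<open>le\<close> at \<open>u + t *\<^sub>R w\<close>: the gain
    \<open>2 * t * a\<close> is of first order in \<open>t\<close>, the loss
    \<open>t\<^sup>2 * b\<close> of second order.\<close>
  have quad: "2 * t * a \<le> t\<^sup>2 * b" for t
  proof -
    have "u + t *\<^sub>R w \<in> V" using uV wV V by (auto intro!: subspace_add subspace_scale)
    from le[OF this] have "c + 2 * t * (w \<bullet> f u) + t\<^sup>2 * (w \<bullet> f w)
        \<le> c * (1 + 2 * t * (w \<bullet> u) + t\<^sup>2 * a)"
      using sa[of w u] sa[of u w] uu
      by (simp add: f.add f.scaleR inner_add inner_commute c_def a_def power2_eq_square algebra_simps)
    moreover have "w \<bullet> f u = a + c * (w \<bullet> u)"
      unfolding a_def by (subst (3) w_def) (simp add: inner_diff inner_add)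
    ultimately show ?thesis unfolding b_def by (simp add: algebra_simps)
  qed
  have "a = 0"
  proof (rule ccontr)
    assume "a \<noteq> 0"
    \<comment> \<open>Small enough for the linear term to win; the \<open>+ 1\<close> keeps the
      denominator positive when \<open>b = 0\<close>.\<close>
    define t where "t = a / (b + 1)"
    have t: "a = t * (b + 1)" using b0 by (simp add: t_def)
    have "t\<^sup>2 * (b + 2) \<le> 0"
      using quad[of t] unfolding t by (simp add: power2_eq_square algebra_simps)
    moreover have "t \<noteq> 0" using \<open>a \<noteq> 0\<close> t by auto
    ultimately show False using b0 by (simp add: mult_le_0_iff)
  qed
  then have "f u = c *\<^sub>R u" by (simp add: a_def w_def)
  then show ?thesis using that uV uu by (simp add: norm_eq_1)
qed

text \<open>Induction on the dimension: split off a unit eigenvector \<open>u\<close>;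
  self-adjointness keeps the orthogonal complement of \<open>u\<close> in \<open>V\<close>
  invariant. The statement is about invariant subspaces so that the induction hypothesis applies to
  that complement.\<close>

lemma self_adjoint_orthonormal_eigenbasis:
  fixes f :: "'a::euclidean_space \<Rightarrow> 'a"
  assumes f: "linear f" and sa: "\<And>x y. f x \<bullet> y = x \<bullet> f y"
    and V: "subspace V" "f ` V \<subseteq> V"
  shows "\<exists>B. pairwise orthogonal B \<and> (\<forall>b\<in>B. norm b = 1 \<and> (\<exists>c. f b = c *\<^sub>R b)) \<and> span B = V"
  using V
proof (induction "dim V" arbitrary: V rule: less_induct)
  case less
  show ?case
  proof (cases "V = {0}")
    case True
    then show ?thesis by (intro exI[of _ "{}"]) auto
  next
    case False
    from self_adjoint_eigenvector_exists[OF f sa less.prems False] obtain u c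
      where u: "u \<in> V" "norm u = 1" "f u = c *\<^sub>R u" by blast
    have uu: "u \<bullet> u = 1" using u by (simp add: norm_eq_1)
    define V' where "V' = V \<inter> {x. u \<bullet> x = 0}"
    have sV': "subspace V'"
      unfolding V'_def using less.prems(1) subspace_hyperplane by (rule subspace_inter)
    have fV': "f ` V' \<subseteq> V'"
    proof
      fix y assume "y \<in> f ` V'"
      then obtain x where x: "x \<in> V" "u \<bullet> x = 0" "y = f x" by (auto simp: V'_def)
      have "u \<bullet> y = 0" using sa[of u x] u x by simp
      then show "y \<in> V'" using x less.prems(2) by (auto simp: V'_def)
    qed
    have "u \<notin> V'" using uu by (simp add: V'_def)
    then have "V' \<subset> V" using u(1) unfolding V'_def by blast
    then have "dim V' < dim V"
      using sV' less.prems(1) by (metis dim_psubset span_eq_iff)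
    from less.hyps[OF this sV' fV'] obtain B where
      B: "pairwise orthogonal B" "\<forall>b\<in>B. norm b = 1 \<and> (\<exists>c. f b = c *\<^sub>R b)" "span B = V'"
      by blast
    have "B \<subseteq> V'" using B span_superset by blast
    then have orth: "pairwise orthogonal (insert u B)"
      using B(1) by (auto simp: pairwise_insert V'_def orthogonal_def inner_commute)
    have "span (insert u B) = V"
    proof
      show "span (insert u B) \<subseteq> V"
        using u less.prems(1) \<open>B \<subseteq> V'\<close> by (intro span_minimal) (auto simp: V'_def)
      show "V \<subseteq> span (insert u B)"
      proof
        fix x assume x: "x \<in> V"
        have "x - (u \<bullet> x) *\<^sub>R u \<in> V'"
          using x u less.prems(1) uu
          by (auto simp: V'_def inner_diff intro!: subspace_diff subspace_scale)
        then show "x \<in> span (insert u B)" using B(3) span_insert by blast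
      qed
    qed
    then show ?thesis using orth B(2) u by (intro exI[of _ "insert u B"]) auto
  qed
qed

section \<open>Diagonal matrices and orthogonal diagonalization\<close>

lemma Diag_mult_left: "(Diag d ** M) $ i $ j = d i * M $ i $ j"
  by (simp add: Diag_def matrix_matrix_mult_def if_distrib[of "\<lambda>x. x * _"] cong: if_cong)

lemma Diag_mult_right: "(M ** Diag d) $ i $ j = M $ i $ j * d j"
  by (simp add: Diag_def matrix_matrix_mult_def if_distrib[of "\<lambda>x. _ * x"] cong: if_cong)

lemma Diag_mult: "Diag d ** Diag e = Diag (\<lambda>i. d i * e i)"
  by (simp add: vec_eq_iff Diag_mult_left) (simp add: Diag_def)

lemma transpose_Diag [simp]: "transpose (Diag d) = Diag d"
  by (simp add: Diag_def transpose_def vec_eq_iff)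

lemma Diag_1: "Diag (\<lambda>i. 1) = mat 1"
  by (simp add: Diag_def mat_def)

lemma Diag_vec: "(Diag d *v x) $ i = d i * x $ i"
  by (simp add: Diag_def matrix_vector_mult_def if_distrib[of "\<lambda>x. x * _"] cong: if_cong)

lemma trace_Diag: "trace (Diag d) = (\<Sum>i\<in>UNIV. d i)"
  by (simp add: trace_def Diag_def)

lemma inner_symmetric_matrix:
  fixes A :: "real^'n^'n"
  assumes "transpose A = A"
  shows "(A *v x) \<bullet> y = x \<bullet> (A *v y)"
  using dot_lmul_matrix[of x A y] transpose_matrix_vector[of A x] assms by metis

theorem spectral_decomposition:
  fixes A :: "real^'n^'n"
  assumes A: "transpose A = A"
  obtains U d where "orthogonal_matrix U" "A = U ** Diag d ** transpose U"
proof -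
  have "\<exists>B. pairwise orthogonal B \<and> (\<forall>b\<in>B. norm b = 1 \<and> (\<exists>c. A *v b = c *\<^sub>R b)) \<and> span B = UNIV"
    by (rule self_adjoint_orthonormal_eigenbasis) (auto simp: inner_symmetric_matrix[OF A])
  then obtain B where B: "pairwise orthogonal B" "\<And>b. b \<in> B \<Longrightarrow> norm b = 1"
    "\<And>b. b \<in> B \<Longrightarrow> \<exists>c. A *v b = c *\<^sub>R b" "span B = UNIV" by blast
  have "independent B" using B(1,2) by (intro pairwise_orthogonal_independent) (auto dest: B(2))
  then have "finite B" "card B = CARD('n)"
    using B(4) dim_span_eq_card_independent[of B] by (auto simp: independent_imp_finite)
  then obtain h :: "'n \<Rightarrow> real^'n" where h: "bij_betw h UNIV B"
    using finite_same_card_bij by (metis finite_class.finite_UNIV)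
  then have hB: "h j \<in> B" for j by (auto simp: bij_betw_def)
  from B(3)[OF hB] have "\<forall>j. \<exists>c. A *v h j = c *\<^sub>R h j" by blast
  then obtain d where d: "\<And>j. A *v h j = d j *\<^sub>R h j" by metis
  define U :: "real^'n^'n" where "U = (\<chi> i j. h j $ i)"
  have col: "column j U = h j" for j by (simp add: column_def U_def)
  have U: "orthogonal_matrix U"
    unfolding orthogonal_matrix_orthonormal_columns col
    using B hB h by (auto simp: pairwise_def bij_betw_def inj_eq)
  have "A ** U = U ** Diag d"
  proof -
    have "(A ** U) $ i $ j = (A *v h j) $ i" for i j
      by (simp add: matrix_matrix_mult_def matrix_vector_mult_def U_def)
    then show ?thesis by (simp add: vec_eq_iff d Diag_mult_right) (simp add: U_def)
  qed
  then have "U ** Diag d ** transpose U = A"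
    using U by (metis matrix_mul_assoc matrix_mul_rid orthogonal_matrix_def)
  then show ?thesis using that U by metis
qed

section \<open>Square roots, polar factors and the nuclear norm\<close>

lemma inner_eq_trace:
  fixes A B :: "real^'m^'n"
  shows "A \<bullet> B = trace (transpose A ** B)"
  unfolding trace_def transpose_def matrix_matrix_mult_def inner_vec_def
  by (simp, subst sum.swap, rule refl)

lemma inner_transpose:
  fixes A B :: "real^'m^'n"
  shows "transpose A \<bullet> transpose B = A \<bullet> B"
  unfolding inner_vec_def transpose_def by (simp, subst sum.swap, rule refl)

lemma norm_transpose_matrix:
  fixes A :: "real^'m^'n"
  shows "norm (transpose A) = norm A"
  by (simp add: norm_eq_sqrt_inner inner_transpose)

lemma inner_matrix_mult_left:
  fixes A :: "real^'k^'n" and B :: "real^'m^'k" and C :: "real^'m^'n"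
  shows "(A ** B) \<bullet> C = B \<bullet> (transpose A ** C)"
  by (simp add: inner_eq_trace matrix_transpose_mul matrix_mul_assoc)

lemma inner_matrix_mult_right:
  fixes A :: "real^'k^'n" and B :: "real^'m^'k" and C :: "real^'m^'n"
  shows "(A ** B) \<bullet> C = A \<bullet> (C ** transpose B)"
proof -
  have "(A ** B) \<bullet> C = (transpose B ** transpose A) \<bullet> transpose C"
    using inner_transpose[of "A ** B" C] by (simp add: matrix_transpose_mul)
  also have "\<dots> = transpose A \<bullet> transpose (C ** transpose B)"
    by (simp add: inner_matrix_mult_left matrix_transpose_mul)
  finally show ?thesis by (simp add: inner_transpose)
qed

lemma norm_matrix_sq:
  fixes A :: "real^'m^'n"
  shows "(norm A)\<^sup>2 = trace (A ** transpose A)" "(norm A)\<^sup>2 = trace (transpose A ** A)"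
  unfolding power2_norm_eq_inner inner_eq_trace by (rule trace_mul_sym, rule refl)

lemma norm_matrix_rows: "(norm (A :: real^'m^'n))\<^sup>2 = (\<Sum>i\<in>UNIV. (norm (A $ i))\<^sup>2)"
  by (simp add: power2_norm_eq_inner inner_vec_def)

lemma norm_matrix_columns:
  "(norm (A :: real^'m^'n))\<^sup>2 = (\<Sum>j\<in>UNIV. (norm (column j A))\<^sup>2)"
proof -
  have "transpose A $ j = column j A" for j by (simp add: transpose_def column_def)
  then show ?thesis
    using norm_matrix_rows[of "transpose A"] by (simp add: norm_transpose_matrix)
qed

lemma column_mult: "column j (A ** B) = A *v column j B"
  by (simp add: column_def matrix_matrix_mult_def matrix_vector_mult_def)

text \<open>The squared Frobenius norm is the sum of the squared column norms, and \<open>A\<close>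
  acts on each column of \<open>B\<close> separately. Hence an operator bound on \<open>A\<close>
  passes to products with the same constant.\<close>

lemma norm_mult_left_bound:
  fixes A :: "real^'k^'n" and B :: "real^'m^'k"
  assumes "\<And>x. norm (A *v x) \<le> c * norm x" and "0 \<le> c"
  shows "norm (A ** B) \<le> c * norm B"
proof (rule power2_le_imp_le)
  have "(norm (A ** B))\<^sup>2 \<le> (\<Sum>j\<in>UNIV. (c * norm (column j B))\<^sup>2)"
    unfolding norm_matrix_columns column_mult by (intro sum_mono power_mono assms) auto
  then show "(norm (A ** B))\<^sup>2 \<le> (c * norm B)\<^sup>2"
    by (simp add: power_mult_distrib norm_matrix_columns sum_distrib_left)
qed (use assms in auto)

lemma norm_matrix_vector_le:
  fixes A :: "real^'m^'n"
  shows "norm (A *v x) \<le> norm A * norm x"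
proof (rule power2_le_imp_le)
  have "(norm (A *v x))\<^sup>2 = (\<Sum>i\<in>UNIV. (A $ i \<bullet> x)\<^sup>2)"
    by (subst power2_norm_eq_inner) (simp add: inner_vec_def[of "A *v x"] matrix_vector_mul_component power2_eq_square)
  also have "\<dots> \<le> (\<Sum>i\<in>UNIV. (norm (A $ i) * norm x)\<^sup>2)"
    by (intro sum_mono abs_le_square_iff[THEN iffD1]) (simp add: Cauchy_Schwarz_ineq2)
  finally show "(norm (A *v x))\<^sup>2 \<le> (norm A * norm x)\<^sup>2"
    by (simp add: power_mult_distrib norm_matrix_rows sum_distrib_right)
qed auto

lemma norm_matrix_mult_le:
  fixes A :: "real^'k^'n" and B :: "real^'m^'k"
  shows "norm (A ** B) \<le> norm A * norm B"
  by (rule norm_mult_left_bound) (auto simp: norm_matrix_vector_le)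

section \<open>Rank, trace and square roots of conjugated diagonal matrices\<close>

lemma rank_Diag: "rank (Diag d :: real^'n^'n) = card {i. d i \<noteq> 0}"
proof -
  have "range ((*v) (Diag d)) = {x. \<forall>i. i \<notin> {i. d i \<noteq> 0} \<longrightarrow> x $ i = 0}" (is "?R = ?S")
  proof
    show "?R \<subseteq> ?S" by (auto simp: Diag_vec)
    show "?S \<subseteq> ?R"
    proof
      fix x assume "x \<in> ?S"
      then have "x = Diag d *v (\<chi> i. x $ i / d i)" by (auto simp: vec_eq_iff Diag_vec)
      then show "x \<in> ?R" by blast
    qed
  qed
  then show ?thesis using dim_substandard_cart[of "{i. d i \<noteq> 0}", where 'a = real] by (simp only: rank_dim_range dim_vec_eq)
qed

lemma rank_mult_left_cancel:
  fixes A :: "real^'n^'n" and B :: "real^'m^'n"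
  assumes "invertible A"
  shows "rank (A ** B) = rank B"
proof (rule antisym)
  obtain A' where "A' ** A = mat 1" using assms by (auto simp: invertible_def)
  then have "B = A' ** (A ** B)" by (simp add: matrix_mul_assoc)
  then show "rank B \<le> rank (A ** B)" using rank_mul_le_right[of A' "A ** B"] by simp
qed (rule rank_mul_le_right)

lemma transpose_conjugate_Diag [simp]:
  "transpose (U ** Diag d ** transpose U) = U ** Diag d ** transpose (U::real^'k^'n)"
  by (simp add: matrix_transpose_mul matrix_mul_assoc)

lemma conjugate_Diag_mult:
  fixes U :: "real^'k^'n"
  assumes "transpose U ** U = mat 1"
  shows "(U ** Diag d ** transpose U) ** (U ** Diag e ** transpose U)
       = U ** Diag (\<lambda>i. d i * e i) ** transpose U"
proof -
  have "(U ** Diag d ** transpose U) ** (U ** Diag e ** transpose U)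
      = U ** Diag d ** (transpose U ** U) ** Diag e ** transpose U"
    by (simp add: matrix_mul_assoc)
  also have "\<dots> = U ** (Diag d ** Diag e) ** transpose U"
    by (simp add: assms matrix_mul_assoc)
  finally show ?thesis by (simp add: Diag_mult)
qed

lemma trace_conjugate_Diag:
  fixes U :: "real^'k^'n"
  assumes "transpose U ** U = mat 1"
  shows "trace (U ** Diag d ** transpose U) = (\<Sum>i\<in>UNIV. d i)"
proof -
  have "trace (U ** Diag d ** transpose U) = trace (transpose U ** U ** Diag d)"
    by (simp add: trace_mul_sym[of "U ** Diag d"] matrix_mul_assoc)
  then show ?thesis by (simp add: assms trace_Diag)
qed

lemma rank_conjugate_Diag:
  fixes U :: "real^'n^'n"
  assumes "orthogonal_matrix U"
  shows "rank (U ** Diag d ** transpose U) = card {i. d i \<noteq> 0}"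
proof -
  have inv: "invertible U" "invertible (transpose U)"
    using assms by (auto simp: invertible_def orthogonal_matrix_def)
  have "rank (U ** Diag d ** transpose U) = rank (Diag d ** transpose U)"
    by (simp add: rank_mult_left_cancel inv flip: matrix_mul_assoc)
  also have "\<dots> = rank (U ** Diag d)"
    using rank_transpose[of "U ** Diag d"] by (simp add: matrix_transpose_mul)
  finally show ?thesis by (simp add: rank_mult_left_cancel inv rank_Diag)
qed

lemma pos_semidef_conjugate_Diag:
  fixes U :: "real^'k^'n"
  assumes "\<And>i. 0 \<le> d i"
  shows "pos_semidef (U ** Diag d ** transpose U)"
  unfolding pos_semidef_def
proof (intro conjI allI)
  fix x
  define y where "y = transpose U *v x"
  have "x \<bullet> ((U ** Diag d ** transpose U) *v x) = x \<bullet> (U *v (Diag d *v y))"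
    unfolding y_def by (simp only: matrix_vector_mul_assoc matrix_mul_assoc)
  also have "\<dots> = (x v* U) \<bullet> (Diag d *v y)" by (simp add: dot_lmul_matrix)
  also have "\<dots> = y \<bullet> (Diag d *v y)" by (simp add: y_def)
  also have "\<dots> = (\<Sum>i\<in>UNIV. d i * (y $ i)\<^sup>2)"
    by (simp add: inner_vec_def Diag_vec power2_eq_square mult_ac)
  finally show "0 \<le> x \<bullet> ((U ** Diag d ** transpose U) *v x)"
    using assms by (simp add: sum_nonneg)
qed simp

lemma conjugate_Diag_eigenvector:
  fixes U :: "real^'n^'n"
  assumes "orthogonal_matrix U"
  shows "(U ** Diag d ** transpose U) *v column i U = d i *\<^sub>R column i U"
proof -
  have "U ** Diag d ** transpose U ** U = U ** Diag d"
    using assms by (simp add: orthogonal_matrix_def flip: matrix_mul_assoc)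
  moreover have "column i (U ** Diag d) = d i *\<^sub>R column i U"
    by (simp add: vec_eq_iff column_def Diag_mult_right)
  ultimately show ?thesis by (metis column_mult)
qed

lemma column_orthogonal_unit:
  fixes U :: "real^'n^'n"
  assumes "orthogonal_matrix U"
  shows "norm (column i U) = 1"
  using assms by (simp add: orthogonal_matrix_orthonormal_columns)

text \<open>This justifies the definite description in \<open>psd_sqrt\<close>. Only the difference
  \<open>B - C\<close> is diagonalized: for a unit eigenvector \<open>u\<close> with eigenvalue
  \<open>d i\<close>, equality of the squares gives \<open>d i = 0\<close> or
  \<open>u \<bullet> (B *v u) + u \<bullet> (C *v u) = 0\<close>; in the second case both
  nonnegative summands vanish, and so does their difference \<open>d i\<close>.\<close>

lemma pos_semidef_sqrt_unique:
  fixes B C :: "real^'n^'n"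
  assumes B: "pos_semidef B" and C: "pos_semidef C" and eq: "B ** B = C ** C"
  shows "B = C"
proof -
  have sB: "transpose B = B" and sC: "transpose C = C" using B C by (auto simp: pos_semidef_def)
  have "transpose (B - C) = B - C" using sB sC by (simp add: transpose_def vec_eq_iff)
  then obtain U d where U: "orthogonal_matrix U" and d: "B - C = U ** Diag d ** transpose U"
    using spectral_decomposition by blast
  have "d i = 0" for i
  proof -
    define u where "u = column i U"
    have uu: "u \<bullet> u = 1" using column_orthogonal_unit[OF U, of i] by (simp add: u_def norm_eq_1)
    have e: "B *v u - C *v u = d i *\<^sub>R u"
      using conjugate_Diag_eigenvector[OF U, of d i] unfolding u_def d[symmetric]
      by (simp add: matrix_vector_mult_diff_rdistrib)
    \<comment> \<open>\<open>0 = u \<bullet> (B\<^sup>2 - C\<^sup>2) u\<close> with \<open>B\<^sup>2 - C\<^sup>2 = B (B - C) + (B - C) C\<close>\<close>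
    have "(B *v u) \<bullet> (B *v u) = (C *v u) \<bullet> (C *v u)"
      using eq by (simp add: inner_symmetric_matrix[OF sB] inner_symmetric_matrix[OF sC] matrix_vector_mul_assoc)
    then have "(B *v u - C *v u) \<bullet> (B *v u + C *v u) = 0"
      by (simp add: inner_diff inner_add inner_commute)
    then have "d i = 0 \<or> u \<bullet> (B *v u) + u \<bullet> (C *v u) = 0"
      unfolding e by (simp add: inner_add_right flip: distrib_left)
    moreover have "u \<bullet> (B *v u) \<ge> 0" "u \<bullet> (C *v u) \<ge> 0" using B C by (auto simp: pos_semidef_def)
    moreover have "u \<bullet> (B *v u) - u \<bullet> (C *v u) = d i"
      using arg_cong[OF e, of "\<lambda>x. u \<bullet> x"] uu by (simp add: inner_diff)
    ultimately show ?thesis by auto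
  qed
  then have "Diag d = 0" by (simp add: vec_eq_iff Diag_def)
  then have "B - C = 0" unfolding d by simp
  then show ?thesis by simp
qed

lemma psd_sqrt_eqI:
  assumes "pos_semidef B" "B ** B = A"
  shows "psd_sqrt A = B"
  unfolding psd_sqrt_def by (rule the_equality) (use assms pos_semidef_sqrt_unique in auto)

lemma psd_sqrt_conjugate_Diag:
  fixes U :: "real^'k^'n"
  assumes "transpose U ** U = mat 1" "\<And>i. 0 \<le> d i"
  shows "psd_sqrt (U ** Diag d ** transpose U) = U ** Diag (\<lambda>i. sqrt (d i)) ** transpose U"
  by (rule psd_sqrt_eqI) (use assms in \<open>auto intro!: pos_semidef_conjugate_Diag simp: conjugate_Diag_mult\<close>)

lemma psd_sqrt_Diag:
  assumes "\<And>i. 0 \<le> d i"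
  shows "psd_sqrt (Diag d) = Diag (\<lambda>i. sqrt (d i))"
  using psd_sqrt_conjugate_Diag[of "mat 1" d] assms by simp

text \<open>A substitute for the singular value decomposition: in an eigenbasis of the Gram matrix
  the rows of \<open>transpose U ** X\<close> are orthogonal, with the singular values as norms. So
  \<open>d\<close> is nonnegative, and \<open>d i = 0\<close> forces the whole row \<open>i\<close>
  to vanish.\<close>

lemma gram_spectral_decomposition:
  fixes X :: "real^'m^'n"
  obtains U d where "orthogonal_matrix U" "X ** transpose X = U ** Diag d ** transpose U"
    "\<And>i. d i = (norm ((transpose U ** X) $ i))\<^sup>2"
proof -
  have "transpose (X ** transpose X) = X ** transpose X" by (simp add: matrix_transpose_mul)
  then obtain U d where U: "orthogonal_matrix U" and d: "X ** transpose X = U ** Diag d ** transpose U"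
    using spectral_decomposition by blast
  have "Diag d = transpose U ** (U ** Diag d ** transpose U) ** U"
    using U by (simp add: orthogonal_matrix_def matrix_mul_assoc)
       (simp add: orthogonal_matrix_def flip: matrix_mul_assoc)
  also have "\<dots> = (transpose U ** X) ** transpose (transpose U ** X)"
    by (simp add: d[symmetric] matrix_transpose_mul matrix_mul_assoc)
  finally have D: "Diag d = (transpose U ** X) ** transpose (transpose U ** X)" .
  have "d i = (norm ((transpose U ** X) $ i))\<^sup>2" for i
  proof -
    have "d i = Diag d $ i $ i" by (simp add: Diag_def)
    then show ?thesis unfolding D
      by (simp add: matrix_matrix_mult_def[of "transpose U ** X"] transpose_def[of "transpose U ** X"] power2_norm_eq_inner inner_vec_def)
  qed
  with U d that show ?thesis by blast
qed

lemma le_of_mult_self_le: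
  fixes a b :: real
  assumes "a * a \<le> b * a" "0 \<le> a" "0 \<le> b"
  shows "a \<le> b"
  using assms by (cases "a = 0") (auto simp: mult_le_cancel_right)

section \<open>Contractions, polar factors and duality for the nuclear norm\<close>

text \<open>The unit ball of the operator norm, which is dual to the nuclear norm.\<close>

definition contraction :: "real^'m^'n \<Rightarrow> bool" where
  "contraction Q \<longleftrightarrow> (\<forall>x. norm (Q *v x) \<le> norm x)"

lemma contraction_transpose:
  fixes Q :: "real^'m^'n"
  assumes "contraction Q"
  shows "contraction (transpose Q)"
  unfolding contraction_def
proof
  fix x
  define y where "y = transpose Q *v x"
  have "norm y * norm y = x \<bullet> (Q *v y)"
    unfolding y_def by (simp add: power2_norm_eq_inner dot_lmul_matrix flip: power2_eq_square)
  also have "\<dots> \<le> norm x * norm (Q *v y)" by (rule norm_cauchy_schwarz)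
  also have "\<dots> \<le> norm x * norm y"
    using assms by (auto simp: contraction_def intro!: mult_left_mono)
  finally show "norm (transpose Q *v x) \<le> norm x" unfolding y_def[symmetric]
    by (rule le_of_mult_self_le) auto
qed

text \<open>Here \<open>P = Q ** transpose Q\<close> is an orthogonal projection, so
  \<open>transpose Q *v x\<close> has squared norm \<open>x \<bullet> (P *v x)\<close>, at most the
  squared norm of \<open>x\<close>. The bound passes to \<open>Q\<close> by transposition.\<close>

lemma contraction_idempotent:
  fixes Q :: "real^'m^'n"
  assumes "(Q ** transpose Q) ** (Q ** transpose Q) = Q ** transpose Q"
  shows "contraction Q"
proof -
  have "contraction (transpose Q)"
    unfolding contraction_def
  proof
    fix x
    define P where "P = Q ** transpose Q"
    have sP: "transpose P = P" by (simp add: P_def matrix_transpose_mul)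
    have Qx: "(norm (transpose Q *v x))\<^sup>2 = x \<bullet> (P *v x)"
    proof -
      have "x \<bullet> (P *v x) = x \<bullet> (Q *v (transpose Q *v x))" unfolding P_def by (simp only: matrix_vector_mul_assoc)
      then show ?thesis by (simp add: power2_norm_eq_inner dot_lmul_matrix)
    qed
    have "x \<bullet> (P *v x) = (norm (P *v x))\<^sup>2"
      unfolding power2_norm_eq_inner inner_symmetric_matrix[OF sP] matrix_vector_mul_assoc
      using assms by (simp add: P_def)
    then have "(norm (P *v x))\<^sup>2 \<le> norm x * norm (P *v x)"
      using norm_cauchy_schwarz[of x "P *v x"] by simp
    then have "norm (P *v x) \<le> norm x"
      unfolding power2_eq_square by (rule le_of_mult_self_le) auto
    then have "(norm (transpose Q *v x))\<^sup>2 \<le> (norm x)\<^sup>2"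
      using Qx norm_cauchy_schwarz[of x "P *v x"] mult_left_mono[of "norm (P *v x)" "norm x" "norm x"]
      by (simp add: power2_eq_square)
    then show "norm (transpose Q *v x) \<le> norm x" by (rule power2_le_imp_le) simp
  qed
  from contraction_transpose[OF this] show ?thesis by simp
qed

text \<open>In an eigenbasis \<open>U\<close> of the Gram matrix the right side is the sum of the
  row norms of \<open>transpose U ** X\<close>. The rows of \<open>transpose U ** Q\<close> have
  norm at most 1, so Cauchy-Schwarz applies row by row.\<close>

lemma contraction_inner_le_trace_sqrt:
  fixes Q X :: "real^'m^'n"
  assumes "contraction Q"
  shows "Q \<bullet> X \<le> trace (psd_sqrt (X ** transpose X))"
proof -
  obtain U d where U: "orthogonal_matrix U" and d: "X ** transpose X = U ** Diag d ** transpose U"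
    and di: "\<And>i. d i = (norm ((transpose U ** X) $ i))\<^sup>2"
    using gram_spectral_decomposition[of X] by blast
  have Ut: "transpose U ** U = mat 1" "U ** transpose U = mat 1" using U by (auto simp: orthogonal_matrix_def)
  have "trace (psd_sqrt (X ** transpose X)) = (\<Sum>i\<in>UNIV. sqrt (d i))"
    unfolding d using Ut di by (simp add: psd_sqrt_conjugate_Diag trace_conjugate_Diag)
  also have "\<dots> = (\<Sum>i\<in>UNIV. norm ((transpose U ** X) $ i))" by (simp add: di)
  also have "\<dots> \<ge> (\<Sum>i\<in>UNIV. (transpose U ** Q) $ i \<bullet> (transpose U ** X) $ i)"
  proof (rule sum_mono)
    fix i
    have "(transpose U ** Q) $ i = transpose Q *v column i U"
      by (simp add: vec_eq_iff matrix_matrix_mult_def matrix_vector_mult_def column_def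
          transpose_def mult.commute del: transpose_matrix_vector)
    then have "norm ((transpose U ** Q) $ i) \<le> 1"
      using contraction_transpose[OF assms] column_orthogonal_unit[OF U, of i] unfolding contraction_def by metis
    then show "(transpose U ** Q) $ i \<bullet> (transpose U ** X) $ i \<le> norm ((transpose U ** X) $ i)"
      using norm_cauchy_schwarz[of "(transpose U ** Q) $ i" "(transpose U ** X) $ i"]
        mult_right_mono[of "norm ((transpose U ** Q) $ i)" 1 "norm ((transpose U ** X) $ i)"] by simp
  qed
  also have "(\<Sum>i\<in>UNIV. (transpose U ** Q) $ i \<bullet> (transpose U ** X) $ i) = (transpose U ** Q) \<bullet> (transpose U ** X)"
    by (simp add: inner_vec_def)
  also have "\<dots> = Q \<bullet> X" by (simp add: inner_matrix_mult_left matrix_mul_assoc Ut)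
  finally show ?thesis by simp
qed

text \<open>The factor is the pseudoinverse of the root of \<open>X ** transpose X\<close>, times
  \<open>X\<close>. It attains the bound of \<open>contraction_inner_le_trace_sqrt\<close>, and
  \<open>Q ** transpose Q\<close> is a projection whose trace is controlled by the rank of
  \<open>X\<close>.\<close>

lemma polar_factor_exists:
  fixes X :: "real^'m^'n"
  obtains Q where "contraction Q" "Q ** transpose X = psd_sqrt (X ** transpose X)"
    "(Q ** transpose Q) ** (Q ** transpose Q) = Q ** transpose Q" "trace (Q ** transpose Q) \<le> rank X"
    "pos_semidef (psd_sqrt (X ** transpose X))"
    "psd_sqrt (X ** transpose X) ** psd_sqrt (X ** transpose X) = X ** transpose X"
    "psd_sqrt (X ** transpose X) ** Q = X"
proof -
  obtain U d where U: "orthogonal_matrix U" and d: "X ** transpose X = U ** Diag d ** transpose U"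
    and di: "\<And>i. d i = (norm ((transpose U ** X) $ i))\<^sup>2"
    using gram_spectral_decomposition[of X] by blast
  have Ut: "transpose U ** U = mat 1" "U ** transpose U = mat 1" using U by (auto simp: orthogonal_matrix_def)
  define p where "p i = sqrt (d i)" for i
  \<comment> \<open>Since \<open>1 / 0 = 0\<close>, this is the Moore-Penrose inverse of the square
    root.\<close>
  define I where "I = U ** Diag (\<lambda>i. 1 / p i) ** transpose U"
  define Q where "Q = I ** X"
  have dp: "d i = p i * p i" for i by (simp add: p_def di power2_eq_square)
  have P: "psd_sqrt (X ** transpose X) = U ** Diag p ** transpose U"
    unfolding d p_def using Ut di by (simp add: psd_sqrt_conjugate_Diag)
  have QX: "Q ** transpose X = U ** Diag p ** transpose U"
  proof -
    have "Q ** transpose X = I ** (U ** Diag d ** transpose U)" by (simp add: Q_def d flip: matrix_mul_assoc)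
    moreover have "(\<lambda>i. 1 / p i * d i) = p" by (auto simp: dp)
    ultimately show ?thesis by (simp add: I_def conjugate_Diag_mult Ut)
  qed
  have QQ: "Q ** transpose Q = U ** Diag (\<lambda>i. if p i = 0 then 0 else 1) ** transpose U"
  proof -
    have "transpose Q = transpose X ** I" by (simp add: Q_def I_def matrix_transpose_mul matrix_mul_assoc)
    then have "Q ** transpose Q = (U ** Diag p ** transpose U) ** I"
      using QX by (simp add: matrix_mul_assoc)
    moreover have "(\<lambda>i. p i * (1 / p i)) = (\<lambda>i. if p i = 0 then 0 else 1)" by auto
    ultimately show ?thesis by (simp only: I_def conjugate_Diag_mult Ut)
  qed
  have idem: "(Q ** transpose Q) ** (Q ** transpose Q) = Q ** transpose Q"
  proof -
    have "(\<lambda>i. (if p i = 0 then 0 else 1) * (if p i = 0 then 0 else 1)) = (\<lambda>i. if p i = 0 then 0 else (1::real))" by auto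
    then show ?thesis by (simp only: QQ conjugate_Diag_mult Ut)
  qed
  have "(\<Sum>i\<in>UNIV. if p i = 0 then 0 else 1) = (\<Sum>i\<in>{i. p i \<noteq> 0}. 1::real)"
    by (rule sum.mono_neutral_cong_right) auto
  then have tr: "trace (Q ** transpose Q) = rank (Q ** transpose Q)"
    unfolding QQ rank_conjugate_Diag[OF U] trace_conjugate_Diag[OF Ut(1)]
    by (simp add: if_distrib[of "\<lambda>x. x \<noteq> 0"] cong: if_cong)
  have "rank (Q ** transpose Q) \<le> rank X"
    using rank_mul_le_left[of Q "transpose Q"] rank_mul_le_right[of I X] by (simp add: Q_def)
  then have trX: "trace (Q ** transpose Q) \<le> rank X" using tr by simp
  \<comment> \<open>Multiplying by the root undoes the pseudoinverse on the rows with
    \<open>p i \<noteq> 0\<close>; the other rows of \<open>transpose U ** X\<close> are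
    zero.\<close>
  have PQ: "(U ** Diag p ** transpose U) ** Q = X"
  proof -
    have "X = U ** (transpose U ** X)" by (simp add: matrix_mul_assoc Ut)
    moreover have "Diag (\<lambda>i. p i * (1 / p i)) ** (transpose U ** X) = transpose U ** X"
      (is "?D ** ?Y = ?Y")
    proof -
      have "p i * (1 / p i) * ?Y $ i $ j = ?Y $ i $ j" for i j
        using di[of i] dp[of i] by (cases "p i = 0") auto
      then show ?thesis by (simp only: vec_eq_iff Diag_mult_left) simp
    qed
    moreover have "(U ** Diag p ** transpose U) ** Q = U ** (?D ** (transpose U ** X))"
      by (simp add: Q_def I_def conjugate_Diag_mult Ut matrix_mul_assoc
            conjugate_Diag_mult[OF Ut(1), unfolded matrix_mul_assoc])
    ultimately show ?thesis by simp
  qed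
  have PP: "(U ** Diag p ** transpose U) ** (U ** Diag p ** transpose U) = X ** transpose X"
    unfolding d conjugate_Diag_mult[OF Ut(1)] dp[symmetric] by (rule refl)
  have psd: "pos_semidef (U ** Diag p ** transpose U)"
    by (rule pos_semidef_conjugate_Diag) (simp add: p_def di)
  show ?thesis
    by (rule that[of Q, unfolded P]) (fact contraction_idempotent[OF idem] QX idem trX psd PP PQ)+
qed

text \<open>With the polar factor \<open>Q\<close> of the product, the trace equals the pairing of
  \<open>A\<close> with \<open>Q ** B\<close>; then use Cauchy-Schwarz, contractivity and the
  inequality of the means. Any explicit factorization thus bounds the nuclear norm from above, hence
  the loss from below.\<close>

lemma trace_sqrt_product_le:
  fixes A :: "real^'k^'n" and B :: "real^'k^'m"
  shows "trace (psd_sqrt ((A ** transpose B) ** transpose (A ** transpose B)))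
       \<le> ((norm A)\<^sup>2 + (norm B)\<^sup>2) / 2"
proof -
  define X where "X = A ** transpose B"
  obtain Q where Q: "contraction Q" "Q ** transpose X = psd_sqrt (X ** transpose X)"
    by (rule polar_factor_exists[of X])
  have "trace (psd_sqrt (X ** transpose X)) = Q \<bullet> X"
    unfolding Q(2)[symmetric] using inner_eq_trace[of "transpose Q" "transpose X"]
    by (simp add: inner_transpose)
  also have "\<dots> = A \<bullet> (Q ** B)"
    unfolding X_def by (subst inner_commute) (simp add: inner_matrix_mult_right)
  also have "\<dots> \<le> norm A * norm (Q ** B)" by (rule norm_cauchy_schwarz)
  also have "norm (Q ** B) \<le> norm B"
    using norm_mult_left_bound[of Q 1 B] Q(1) by (simp add: contraction_def)
  then have "norm A * norm (Q ** B) \<le> norm A * norm B" by (simp add: mult_left_mono)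
  also have "\<dots> \<le> ((norm A)\<^sup>2 + (norm B)\<^sup>2) / 2"
    using sum_squares_bound[of "norm A" "norm B"] by simp
  finally show ?thesis unfolding X_def .
qed

section \<open>Index sets, perturbation bounds and the loss in an eigenbasis\<close>

text \<open>Counting smaller elements is strictly increasing with values below
  \<open>CARD('a)\<close>; a comparison of cardinalities makes it onto.\<close>

lemma bij_betw_rank_order:
  "bij_betw (\<lambda>a. card {b. b < a}) (UNIV :: 'a::{finite,linorder} set) {..<CARD('a)}"
proof -
  let ?r = "\<lambda>a::'a. card {b. b < a}"
  have mono: "?r a < ?r b" if "a < b" for a b :: 'a
    by (rule psubset_card_mono) (use that in auto)
  have inj: "inj ?r"
  proof (rule injI)
    fix a b :: 'a assume "?r a = ?r b"
    then show "a = b" using mono[of a b] mono[of b a] by (cases a b rule: linorder_cases) auto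
  qed
  have "?r a < CARD('a)" for a :: 'a by (rule psubset_card_mono) auto
  then have "range ?r \<subseteq> {..<CARD('a)}" by auto
  then have "range ?r = {..<CARD('a)}"
    by (rule card_subset_eq[rotated]) (simp_all add: card_image[OF inj])
  with inj show ?thesis by (simp add: bij_betw_def)
qed

lemma bij_betw_nth_index:
  fixes J :: "'n::{finite,linorder} set"
  assumes "card J = CARD('k::{finite,linorder})"
  shows "bij_betw (nth_index J :: 'k \<Rightarrow> 'n) UNIV J"
proof -
  have "bij_betw ((!) (sorted_list_of_set J)) {..<CARD('k)} J"
    using bij_betw_nth[of "sorted_list_of_set J"] assms by simp
  from bij_betw_trans[OF bij_betw_rank_order this] show ?thesis
    by (simp add: nth_index_def[abs_def] comp_def)
qed

lemma card_first_indices: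
  assumes "k \<le> CARD('n::{finite,linorder})"
  shows "card (first_indices k :: 'n set) = k"
proof -
  have "bij_betw (\<lambda>a::'n. card {b. b < a}) (first_indices k) {..<k}"
    using bij_betw_rank_order[where 'a='n] assms
    unfolding first_indices_def bij_betw_def
    by (auto simp: inj_on_def)
  from bij_betw_same_card[OF this] show ?thesis by simp
qed

lemma first_indices_less:
  assumes "i \<in> first_indices k" "j \<notin> first_indices k"
  shows "i < j"
proof (rule ccontr)
  assume "\<not> i < j"
  then have "card {l. l < j} \<le> card {l. l < i}" by (intro card_mono) auto
  then show False using assms by (simp add: first_indices_def)
qed

section \<open>Quadratic contact, lower norm bounds and factorization through a range\<close>

text \<open>It reduces criticality of the selected matrices to a two-sided quadratic estimate of the
  loss on matrices of the same rank.\<close>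

lemma has_derivative_zero_of_quadratic:
  fixes f :: "'a::real_normed_vector \<Rightarrow> real"
  assumes "0 < e" "\<And>y. y \<in> M \<Longrightarrow> norm (y - x) < e \<Longrightarrow> \<bar>f y - f x\<bar> \<le> K * (norm (y - x))\<^sup>2"
  shows "(f has_derivative (\<lambda>_. 0)) (at x within M)"
  unfolding has_derivative_within_alt
proof (intro conjI allI impI)
  fix r :: real assume r: "0 < r"
  define d where "d = min e (r / (\<bar>K\<bar> + 1))"
  have "0 < d" using assms r by (simp add: d_def)
  moreover have "norm (f y - f x - 0) \<le> r * norm (y - x)" if y: "y \<in> M" "norm (y - x) < d" for y
  proof -
    have "\<bar>K\<bar> * norm (y - x) \<le> (\<bar>K\<bar> + 1) * (r / (\<bar>K\<bar> + 1))"
      using y r by (intro mult_mono) (auto simp: d_def)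
    then have K: "\<bar>K\<bar> * norm (y - x) \<le> r" by simp
    have "\<bar>f y - f x\<bar> \<le> \<bar>K\<bar> * (norm (y - x))\<^sup>2"
      using assms(2)[of y] y mult_right_mono[OF abs_ge_self[of K], of "(norm (y - x))\<^sup>2"]
      by (simp add: d_def)
    also have "\<dots> \<le> r * norm (y - x)"
      using mult_right_mono[OF K norm_ge_zero[of "y - x"]] by (simp add: power2_eq_square mult_ac)
    finally show ?thesis by simp
  qed
  ultimately show "\<exists>d>0. \<forall>y\<in>M. norm (y - x) < d \<longrightarrow> norm (f y - f x - 0) \<le> r * norm (y - x)" by blast
qed simp

lemma norm_mult_lower_bound:
  fixes A :: "real^'k^'n" and B :: "real^'m^'k"
  assumes "\<And>x. c * norm x \<le> norm (A *v x)" and "0 \<le> c"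
  shows "c * norm B \<le> norm (A ** B)"
proof (rule power2_le_imp_le)
  have "(\<Sum>j\<in>UNIV. (c * norm (column j B))\<^sup>2) \<le> (norm (A ** B))\<^sup>2"
    unfolding norm_matrix_columns column_mult by (intro sum_mono power_mono assms) (use assms in auto)
  then show "(c * norm B)\<^sup>2 \<le> (norm (A ** B))\<^sup>2"
    by (simp add: power_mult_distrib norm_matrix_columns sum_distrib_left)
qed auto

lemma norm_Diag_lower_bound:
  assumes "\<And>i. c \<le> d i" and "0 \<le> c"
  shows "c * norm x \<le> norm (Diag d *v x)"
proof (rule power2_le_imp_le)
  have sq: "(norm z)\<^sup>2 = (\<Sum>i\<in>UNIV. (z $ i)\<^sup>2)" for z :: "real^'n"
    unfolding power2_norm_eq_inner inner_vec_def by (simp add: power2_eq_square)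
  have "(\<Sum>i\<in>UNIV. (c * x $ i)\<^sup>2) \<le> (\<Sum>i\<in>UNIV. (d i * x $ i)\<^sup>2)"
    unfolding power_mult_distrib by (intro sum_mono mult_right_mono power_mono) (use assms in auto)
  then show "(c * norm x)\<^sup>2 \<le> (norm (Diag d *v x))\<^sup>2"
    by (simp add: power_mult_distrib sq Diag_vec sum_distrib_left)
qed auto

lemma left_mult_inj_if_bounded_below:
  fixes A :: "real^'k^'n"
  assumes "\<And>x. c * norm x \<le> norm (A *v x)" and "0 < c"
  shows "inj ((*v) A)"
proof (rule injI)
  fix x y assume "A *v x = A *v y"
  then have "c * norm (x - y) \<le> 0" using assms(1)[of "x - y"] by (simp add: matrix_vector_mult_diff_distrib)
  then show "x = y" using assms(2) by (simp add: mult_le_0_iff)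
qed

lemma factor_through_range:
  fixes A :: "real^'k^'n" and X :: "real^'m^'n"
  assumes "range ((*v) X) \<subseteq> range ((*v) A)"
  obtains C where "X = A ** C"
proof -
  have "\<exists>c. column j X = A *v c" for j
    using assms matrix_vector_mult_basis[of X j] by (metis imageE range_subsetD)
  then obtain c where c: "\<And>j. column j X = A *v c j" by metis
  have "X = A ** (\<chi> i j. c j $ i)"
  proof -
    have "X $ i $ j = (A *v c j) $ i" for i j unfolding c[symmetric] by (simp add: column_def)
    then show ?thesis by (simp add: vec_eq_iff matrix_matrix_mult_def matrix_vector_mult_def)
  qed
  then show ?thesis using that by blast
qed

lemma matrix_add_rdistrib: "(A + B) ** C = A ** C + B ** (C :: real^'m^'k)"
  by (simp add: vec_eq_iff matrix_matrix_mult_def distrib_right sum.distrib)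

lemma matrix_diff_ldistrib: "A ** (B - C) = A ** B - A ** (C :: real^'m^'k)"
  by (simp add: vec_eq_iff matrix_matrix_mult_def right_diff_distrib sum_subtractf)

lemma matrix_diff_rdistrib: "(A - B) ** C = A ** C - B ** (C :: real^'m^'k)"
  by (simp add: vec_eq_iff matrix_matrix_mult_def left_diff_distrib sum_subtractf)

section \<open>Selected eigenvectors\<close>

text \<open>The index map is arbitrary, which keeps the analysis free of linear orders;
  \<open>col_submatrix\<close> is the case \<open>h = nth_index J\<close>.\<close>

definition select_columns :: "real^'n^'l \<Rightarrow> ('k \<Rightarrow> 'n) \<Rightarrow> real^'k^'l" where
  "select_columns A h = (\<chi> i a. A $ i $ h a)"

lemma conjugate_Diag_select_columns:
  fixes U :: "real^'n^'n"
  assumes "orthogonal_matrix U"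
  shows "(U ** Diag d ** transpose U) ** select_columns U h = select_columns U h ** Diag (\<lambda>a. d (h a))"
proof -
  have sel: "M ** select_columns U h = select_columns (M ** U) h" for M :: "real^'n^'n"
    by (simp add: vec_eq_iff select_columns_def matrix_matrix_mult_def)
  have "U ** Diag d ** transpose U ** U = U ** Diag d"
    using assms by (simp add: orthogonal_matrix_def flip: matrix_mul_assoc)
  then show ?thesis
    unfolding sel by (simp add: vec_eq_iff select_columns_def Diag_mult_right)
qed

lemma select_columns_orthonormal:
  fixes U :: "real^'n^'n"
  assumes "orthogonal_matrix U" "inj h"
  shows "transpose (select_columns U h) ** select_columns U h = mat 1"
proof -
  have "(transpose (select_columns U h) ** select_columns U h) $ a $ b = (transpose U ** U) $ h a $ h b" for a b
    by (simp add: select_columns_def matrix_matrix_mult_def transpose_def)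
  then show ?thesis
    using assms by (simp add: orthogonal_matrix_def vec_eq_iff mat_def inj_eq)
qed

text \<open>Passes from the thin form with the selected eigenvectors to the full eigenbasis, where
  the entries outside \<open>range h\<close> are zero.\<close>

lemma select_columns_conjugate_Diag:
  fixes U :: "real^'n^'n"
  assumes "inj h"
  shows "select_columns U h ** Diag (\<lambda>a. d (h a)) ** transpose (select_columns U h)
       = U ** Diag (\<lambda>i. if i \<in> range h then d i else 0) ** transpose U"
proof -
  have "(select_columns U h ** Diag (\<lambda>a. d (h a)) ** transpose (select_columns U h)) $ i $ j
      = (\<Sum>a\<in>UNIV. U $ i $ h a * d (h a) * U $ j $ h a)" for i j
    by (simp add: matrix_matrix_mult_def[of "_ ** Diag _"] Diag_mult_right) (simp add: select_columns_def transpose_def)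
  also have "\<dots> i j = (\<Sum>l\<in>range h. U $ i $ l * d l * U $ j $ l)" for i j
    using sum.reindex[OF assms, of "\<lambda>l. U $ i $ l * d l * U $ j $ l"] by (simp add: comp_def)
  also have "\<dots> i j = (\<Sum>l\<in>UNIV. U $ i $ l * (if l \<in> range h then d l else 0) * U $ j $ l)" for i j
    by (rule sum.mono_neutral_cong_left) auto
  also have "\<dots> i j = (U ** Diag (\<lambda>i. if i \<in> range h then d i else 0) ** transpose U) $ i $ j" for i j
    by (simp add: matrix_matrix_mult_def[of "_ ** Diag _"] Diag_mult_right) (simp add: transpose_def)
  finally show ?thesis by (simp add: vec_eq_iff)
qed

text \<open>Distinctness of the eigenvalues is expressed by injectivity of \<open>lam\<close>; their
  order enters only through the top set \<open>J\<close> of \<open>bw_loss_rank_le\<close>.\<close>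

locale bures_wasserstein_target =
  fixes Om :: "real^'n::finite^'n::finite" and lam :: "'n \<Rightarrow> real"
  assumes Om: "orthogonal_matrix Om"
    and lam_pos: "\<And>i. 0 < lam i"
    and lam_inj: "inj lam"
begin

definition Sig :: "real^'n^'n" where "Sig = Om ** Diag lam ** transpose Om"

definition root :: "real^'n^'n" where
  "root = Om ** Diag (\<lambda>i. sqrt (lam i)) ** transpose Om"

lemma Om_mult: "transpose Om ** Om = mat 1" "Om ** transpose Om = mat 1"
  using Om by (auto simp: orthogonal_matrix_def)

lemma transpose_root [simp]: "transpose root = root"
  by (simp add: root_def)

lemma root_root: "root ** root = Sig"
  using lam_pos by (simp add: root_def Sig_def conjugate_Diag_mult Om_mult less_imp_le)

lemma psd_sqrt_Sig: "psd_sqrt Sig = root"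
  using lam_pos by (simp add: root_def Sig_def psd_sqrt_conjugate_Diag Om_mult less_imp_le)

lemma invertible_root: "invertible root"
proof -
  have "sqrt (lam i) \<noteq> 0" for i using lam_pos[of i] by simp
  then have "root ** (Om ** Diag (\<lambda>i. 1 / sqrt (lam i)) ** transpose Om) = mat 1"
    unfolding root_def conjugate_Diag_mult[OF Om_mult(1)] by (simp add: Diag_1 Om_mult)
  then show ?thesis using invertible_right_inverse by blast
qed

lemma bw_loss_Sig:
  fixes W :: "real^'m^'n"
  shows "bw_loss Sig W = (norm W)\<^sup>2 + trace Sig
    - 2 * trace (psd_sqrt ((root ** W) ** transpose (root ** W)))"
proof -
  have "trace (c *\<^sub>R A) = c * trace A" for c and A :: "real^'n^'n"
    by (simp add: trace_def sum_distrib_left)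
  then show ?thesis
    unfolding bw_loss_def psd_sqrt_Sig
    by (simp add: trace_add trace_sub norm_matrix_sq(1) matrix_transpose_mul matrix_mul_assoc)
qed

text \<open>The loss with the nuclear norm of \<open>root ** W\<close> replaced by its pairing with
  \<open>Q\<close>.\<close>

definition majorant :: "real^'m^'n \<Rightarrow> real^'m^'n \<Rightarrow> real" where
  "majorant Q W = (norm W)\<^sup>2 + trace Sig - 2 * ((root ** Q) \<bullet> W)"

lemma bw_loss_le_majorant:
  fixes W :: "real^'m^'n"
  assumes "contraction Q"
  shows "bw_loss Sig W \<le> majorant Q W"
  using contraction_inner_le_trace_sqrt[OF assms, of "root ** W"]
  by (simp add: bw_loss_Sig majorant_def inner_matrix_mult_left)

lemma bw_loss_eq_majorant:
  fixes W :: "real^'m^'n"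
  assumes "Q ** transpose (root ** W) = psd_sqrt ((root ** W) ** transpose (root ** W))"
  shows "bw_loss Sig W = majorant Q W"
proof -
  have "trace (psd_sqrt ((root ** W) ** transpose (root ** W))) = (root ** Q) \<bullet> W"
    unfolding assms[symmetric] using inner_eq_trace[of "transpose Q" "transpose (root ** W)"]
    by (simp add: inner_transpose inner_matrix_mult_left)
  then show ?thesis by (simp add: bw_loss_Sig majorant_def)
qed

lemma majorant_square:
  fixes W :: "real^'m^'n"
  shows "majorant Q W = (norm (W - root ** Q))\<^sup>2 + trace Sig - (norm (root ** Q))\<^sup>2"
  by (simp add: majorant_def power2_norm_eq_inner inner_diff inner_commute)

end

section \<open>Second-order control at the selected matrices\<close>

locale selected_columns = bures_wasserstein_target Om lam
  for Om :: "real^'n::finite^'n::finite" and lam +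
  fixes h :: "'k::finite \<Rightarrow> 'n" and V :: "real^'k^'m::finite"
  assumes h: "inj h" and V: "transpose V ** V = mat 1"
begin

definition U where "U = select_columns Om h"
definition s where "s = (\<lambda>a. sqrt (lam (h a)))"
definition W where "W = U ** Diag s ** transpose V"
text \<open>\<open>T\<close> turns out to be the squared norm of \<open>W\<close> and of both
  factors \<open>U ** Diag s\<close> and \<open>Diag s ** transpose V\<close>, and the amount by
  which the loss at \<open>W\<close> lies below \<open>trace Sig\<close>.\<close>

definition T where "T = (\<Sum>a\<in>UNIV. lam (h a))"

lemma s_pos: "0 < s a" using lam_pos by (simp add: s_def)

lemma s_sq: "s a * s a = lam (h a)" using lam_pos[of "h a"] by (simp add: s_def)

lemma U_orthonormal: "transpose U ** U = mat 1" unfolding U_def by (rule select_columns_orthonormal[OF Om h])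

lemma root_U: "root ** U = U ** Diag s"
  unfolding root_def U_def conjugate_Diag_select_columns[OF Om] s_def ..

text \<open>So \<open>W\<close> is the center of the quadratic
  \<open>majorant (U ** transpose V)\<close>, which gives the upper bound in
  \<open>bw_loss_upper\<close>.\<close>

lemma root_UV: "root ** (U ** transpose V) = W"
  by (simp add: W_def root_U matrix_mul_assoc)

lemma root_W: "root ** W = U ** Diag (\<lambda>a. lam (h a)) ** transpose V"
proof -
  have "root ** W = (root ** U) ** (Diag s ** transpose V)" by (simp add: W_def matrix_mul_assoc)
  also have "\<dots> = U ** (Diag s ** Diag s) ** transpose V" by (simp add: root_U matrix_mul_assoc)
  finally show ?thesis by (simp add: Diag_mult s_sq)
qed

lemma Diag_s_mult_Diag_s: "Diag s ** Diag s = Diag (\<lambda>a. lam (h a))" by (simp add: Diag_mult s_sq)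

lemma norm_U_Diag_s: "(norm (U ** Diag s))\<^sup>2 = T"
proof -
  have "(U ** Diag s) ** transpose (U ** Diag s) = U ** (Diag s ** Diag s) ** transpose U"
    by (simp add: matrix_transpose_mul matrix_mul_assoc)
  then show ?thesis by (simp add: norm_matrix_sq(1) Diag_s_mult_Diag_s trace_conjugate_Diag U_orthonormal T_def)
qed

lemma norm_Diag_s_V: "(norm (Diag s ** transpose V))\<^sup>2 = T"
proof -
  have "(Diag s ** transpose V) ** transpose (Diag s ** transpose V) = Diag s ** (transpose V ** V) ** Diag s"
    by (simp add: matrix_transpose_mul matrix_mul_assoc)
  then show ?thesis by (simp add: norm_matrix_sq(1) Diag_s_mult_Diag_s V trace_Diag T_def)
qed

lemma norm_W: "(norm W)\<^sup>2 = T"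
proof -
  have "W ** transpose W = U ** Diag s ** (transpose V ** V) ** Diag s ** transpose U"
    by (simp add: W_def matrix_transpose_mul matrix_mul_assoc)
  also have "\<dots> = U ** (Diag s ** Diag s) ** transpose U" by (simp add: V matrix_mul_assoc)
  finally show ?thesis by (simp add: norm_matrix_sq(1) Diag_s_mult_Diag_s trace_conjugate_Diag U_orthonormal T_def)
qed

text \<open>The lower bound holds because \<open>W\<close> becomes the identity of size
  \<open>CARD('k)\<close> after multiplication by suitable matrices on both sides.\<close>

lemma rank_W: "rank W = CARD('k)"
proof (rule antisym)
  have "rank W \<le> rank (transpose V)" unfolding W_def by (rule rank_mul_le_right)
  also have "\<dots> \<le> CARD('k)" using rank_bound[of "transpose V"] by simp
  finally show "rank W \<le> CARD('k)" .
  have "Diag (\<lambda>a. 1 / s a) ** transpose U ** W ** V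
      = Diag (\<lambda>a. 1 / s a) ** (transpose U ** U) ** Diag s ** (transpose V ** V)"
    by (simp add: W_def matrix_mul_assoc)
  also have "\<dots> = mat 1"
  proof -
    have "1 / s a * s a = 1" for a using s_pos[of a] by simp
    then show ?thesis by (simp add: U_orthonormal V Diag_mult Diag_1)
  qed
  finally have "rank (Diag (\<lambda>a. 1 / s a) ** transpose U ** W ** V) = CARD('k)" by (simp add: rank_I)
  then show "CARD('k) \<le> rank W"
    using rank_mul_le_left[of "Diag (\<lambda>a. 1 / s a) ** transpose U ** W" V]
      rank_mul_le_right[of "Diag (\<lambda>a. 1 / s a) ** transpose U" W] by (simp add: matrix_mul_assoc)
qed

lemma contraction_UV: "contraction (U ** transpose V)"
proof (rule contraction_idempotent)
  have "(U ** transpose V) ** transpose (U ** transpose V) = U ** (transpose V ** V) ** transpose U"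
    by (simp add: matrix_transpose_mul matrix_mul_assoc)
  moreover have "(U ** transpose U) ** (U ** transpose U) = U ** (transpose U ** U) ** transpose U"
    by (simp add: matrix_mul_assoc)
  ultimately show "(U ** transpose V) ** transpose (U ** transpose V) ** ((U ** transpose V) ** transpose (U ** transpose V))
    = (U ** transpose V) ** transpose (U ** transpose V)"
    by (simp add: V U_orthonormal)
qed

lemma bw_loss_upper: "bw_loss Sig W' \<le> (norm (W' - W))\<^sup>2 + trace Sig - T"
  using bw_loss_le_majorant[OF contraction_UV, of W']
  by (simp add: majorant_square root_UV norm_W)

text \<open>Near \<open>W\<close>, a matrix \<open>X' = root ** W'\<close> of rank
  \<open>CARD('k)\<close> has the same column space as \<open>X' ** V\<close>, so
  \<open>X' = (X' ** V) ** C\<close>. Distributing \<open>Diag s\<close> over the two factors gives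
  \<open>X' = A ** transpose B\<close> for \<open>trace_sqrt_product_le\<close>. Up to second order
  the squared norm of \<open>A\<close> is \<open>T + 2 * (W \<bullet> (W' - W))\<close> and that of
  \<open>B\<close> is \<open>T\<close>; the linear term cancels against the one in the squared norm
  of \<open>W'\<close>.\<close>

lemma bw_loss_lower:
  "\<exists>e K. 0 < e \<and> (\<forall>W'. rank W' = CARD('k) \<longrightarrow> norm (W' - W) < e \<longrightarrow>
     trace Sig - T - K * (norm (W' - W))\<^sup>2 \<le> bw_loss Sig W')"
proof -
  define d where "d = Min (range (\<lambda>a. lam (h a)))"
  have d: "0 < d" "\<And>a. d \<le> lam (h a)"
    using lam_pos by (auto simp: d_def)
  define DI where "DI = Diag (\<lambda>a. 1 / s a)"
  have sI: "1 / s a * s a = 1" "s a * (1 / s a) = 1" for a using s_pos[of a] by auto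
  have DIs: "DI ** Diag s = mat 1" "Diag s ** DI = mat 1"
    by (simp_all add: DI_def Diag_mult sI Diag_1 del: times_divide_eq_left times_divide_eq_right)
  \<comment> \<open>The projection onto the complement of the row space of \<open>W\<close>; it
    annihilates \<open>root ** W\<close> from the right.\<close>
  define N where "N = mat 1 - V ** transpose V"
  define r2 where "r2 = norm (transpose U) * norm root * norm V"
  have r20: "0 \<le> r2" by (simp add: r2_def)
  \<comment> \<open>Within this radius the perturbation \<open>transpose U ** E ** V\<close> of
    \<open>M\<close> has norm at most \<open>d / 2\<close>, half the smallest selected
    eigenvalue.\<close>
  define e where "e = d / (2 * (r2 + 1))"
  define K1 where "K1 = norm root * norm (V ** DI)"
  define K2 where "K2 = norm (Diag s) * (2 / d * (norm (transpose U) * norm root * norm N))"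
  have e: "0 < e" using d r20 by (simp add: e_def)
  have low: "trace Sig - T - (K1\<^sup>2 + K2\<^sup>2) * (norm (W' - W))\<^sup>2 \<le> bw_loss Sig W'"
    if rk: "rank W' = CARD('k)" and near: "norm (W' - W) < e" for W' :: "real^'m^'n"
  proof -
    define \<delta> where "\<delta> = norm (W' - W)"
    define E where "E = root ** (W' - W)"
    define X' where "X' = root ** W'"
    define M where "M = transpose U ** X' ** V"
    have X'E: "X' = root ** W + E" by (simp add: X'_def E_def matrix_diff_ldistrib)
    have nE: "norm E \<le> norm root * \<delta>" unfolding E_def \<delta>_def by (rule norm_matrix_mult_le)
    have ME: "M = Diag (\<lambda>a. lam (h a)) + transpose U ** E ** V"
    proof -
      have "transpose U ** (root ** W) ** V = (transpose U ** U) ** Diag (\<lambda>a. lam (h a)) ** (transpose V ** V)"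
        by (simp add: root_W matrix_mul_assoc)
      then show ?thesis
        by (simp add: M_def X'E matrix_add_ldistrib matrix_add_rdistrib U_orthonormal V)
    qed
    \<comment> \<open>The compression \<open>M\<close> is a small perturbation of the diagonal
      matrix of the selected eigenvalues, so it stays invertible with a uniform lower bound.\<close>
    have Mlow: "d / 2 * norm y \<le> norm (M *v y)" for y
    proof -
      have "norm (transpose U ** E ** V) \<le> norm (transpose U) * norm E * norm V"
        by (meson norm_matrix_mult_le mult_right_mono norm_ge_zero order_trans)
      also have "\<dots> \<le> norm (transpose U) * (norm root * \<delta>) * norm V"
        using nE by (intro mult_right_mono mult_left_mono) auto
      also have "\<dots> = r2 * \<delta>" by (simp add: r2_def)
      also have "\<dots> \<le> (r2 + 1) * e" using near r20 by (intro mult_mono) (auto simp: \<delta>_def)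
      also have "\<dots> = d / 2" using r20 by (simp add: e_def field_simps)
      finally have "norm (transpose U ** E ** V) \<le> d / 2" .
      then have "norm ((transpose U ** E ** V) *v y) \<le> d / 2 * norm y"
        by (meson norm_matrix_vector_le mult_right_mono norm_ge_zero order_trans)
      moreover have "d * norm y \<le> norm (Diag (\<lambda>a. lam (h a)) *v y)"
        by (rule norm_Diag_lower_bound) (use d in auto)
      moreover have "norm (Diag (\<lambda>a. lam (h a)) *v y) \<le> norm (M *v y) + norm ((transpose U ** E ** V) *v y)"
        using norm_triangle_ineq4[of "M *v y" "(transpose U ** E ** V) *v y"]
        by (simp add: ME matrix_vector_mult_add_rdistrib)
      ultimately show ?thesis by (simp add: field_simps)
    qed
    have injM: "inj ((*v) M)" by (rule left_mult_inj_if_bounded_below[OF Mlow]) (use d in auto)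
    have "CARD('k) = rank M" using injM full_rank_injective by metis
    also have "\<dots> \<le> rank (X' ** V)"
      using rank_mul_le_right[of "transpose U" "X' ** V"] by (simp add: M_def matrix_mul_assoc)
    finally have rXV: "CARD('k) \<le> rank (X' ** V)" .
    have rX: "rank X' = CARD('k)" using rk by (simp add: X'_def rank_mult_left_cancel[OF invertible_root])
    have sub: "range ((*v) (X' ** V)) \<subseteq> range ((*v) X')" by (auto simp flip: matrix_vector_mul_assoc)
    \<comment> \<open>Here the exact rank of \<open>W'\<close> enters: the smaller range already has
      dimension \<open>CARD('k)\<close>.\<close>
    have "range ((*v) (X' ** V)) = range ((*v) X')"
      by (rule subspace_dim_equal) (use sub rX rXV in \<open>auto simp: linear_subspace_image simp flip: rank_dim_range\<close>)
    then obtain C where C: "X' = (X' ** V) ** C" using factor_through_range[of X' "X' ** V"] by blast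
    \<comment> \<open>The deviation of \<open>C\<close> from \<open>transpose V\<close>; the
      equation \<open>MC\<close> and the lower bound for \<open>M\<close> make it of order
      \<open>\<delta>\<close>.\<close>
    define C' where "C' = C - transpose V"
    have MC: "M ** C' = transpose U ** E ** N"
    proof -
      have "M ** C = transpose U ** X'" using C by (simp add: M_def flip: matrix_mul_assoc)
      then have "M ** C' = transpose U ** X' ** N"
        by (simp add: C'_def N_def matrix_diff_ldistrib) (simp add: M_def matrix_mul_assoc)
      moreover have "root ** W ** N = 0"
      proof -
        have "transpose V ** N = 0"
          using V by (simp add: N_def matrix_diff_ldistrib matrix_mul_assoc)
        then show ?thesis by (simp add: root_W flip: matrix_mul_assoc)
      qed
      ultimately show ?thesis
        by (simp add: X'E matrix_add_ldistrib matrix_add_rdistrib flip: matrix_mul_assoc)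
    qed
    have nC': "norm C' \<le> 2 / d * (norm (transpose U) * norm root * norm N) * \<delta>"
    proof -
      have "d / 2 * norm C' \<le> norm (transpose U ** E ** N)"
        unfolding MC[symmetric] by (rule norm_mult_lower_bound) (use Mlow d in auto)
      also have "\<dots> \<le> norm (transpose U) * norm E * norm N"
        by (meson norm_matrix_mult_le mult_right_mono norm_ge_zero order_trans)
      also have "\<dots> \<le> norm (transpose U) * (norm root * \<delta>) * norm N"
        using nE by (intro mult_right_mono mult_left_mono) auto
      finally show ?thesis using d by (simp add: field_simps)
    qed
    \<comment> \<open>The correction is orthogonal to \<open>transpose V\<close>, which removes the
      first-order term from the norm of \<open>B\<close>.\<close>
    have C'V: "C' ** V = 0"
    proof -
      have "N ** V = 0" using V by (simp add: N_def matrix_diff_rdistrib flip: matrix_mul_assoc)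
      then have "M ** (C' ** V) = 0" by (simp add: matrix_mul_assoc MC) (simp flip: matrix_mul_assoc)
      then have "d / 2 * norm (C' ** V) \<le> 0"
        using norm_mult_lower_bound[of "d / 2" M "C' ** V"] Mlow d by simp
      then show ?thesis using d by (simp add: mult_le_0_iff)
    qed
    \<comment> \<open>perturbs the balanced factorization \<open>root ** W = (U ** Diag s) ** (Diag s ** transpose V)\<close>\<close>
    define A where "A = X' ** V ** DI"
    define B where "B = transpose (Diag s ** C)"
    have AB: "X' = A ** transpose B"
    proof -
      have "A ** transpose B = X' ** V ** (DI ** Diag s) ** C" by (simp add: A_def B_def matrix_mul_assoc)
      then show ?thesis using C by (simp add: DIs)
    qed
    have nB: "(norm B)\<^sup>2 \<le> T + K2\<^sup>2 * \<delta>\<^sup>2"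
    proof -
      have "(Diag s ** C') \<bullet> (Diag s ** transpose V) = (Diag s ** (C' ** V)) \<bullet> Diag s"
        using inner_matrix_mult_right[of "Diag s" "transpose V" "Diag s ** C'"]
        by (simp add: inner_commute matrix_mul_assoc)
      then have orth: "(Diag s ** C') \<bullet> (Diag s ** transpose V) = 0" by (simp add: C'V)
      have "Diag s ** C = Diag s ** transpose V + Diag s ** C'"
        by (simp add: C'_def matrix_diff_ldistrib)
      then have "(norm B)\<^sup>2 = T + (norm (Diag s ** C'))\<^sup>2"
        using orth norm_Diag_s_V
        by (simp add: B_def norm_transpose_matrix power2_norm_eq_inner inner_add inner_commute)
      moreover have "norm (Diag s ** C') \<le> norm (Diag s) * norm C'" by (rule norm_matrix_mult_le)
      then have "norm (Diag s ** C') \<le> K2 * \<delta>"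
        using mult_left_mono[OF nC' norm_ge_zero[of "Diag s"]] by (simp add: K2_def mult_ac)
      then have "(norm (Diag s ** C'))\<^sup>2 \<le> (K2 * \<delta>)\<^sup>2" by (intro power_mono) auto
      ultimately show ?thesis by (simp add: power_mult_distrib)
    qed
    have nA: "(norm A)\<^sup>2 \<le> T + 2 * (W \<bullet> (W' - W)) + K1\<^sup>2 * \<delta>\<^sup>2"
    proof -
      have "root ** W ** V ** DI = U ** (Diag s ** Diag s) ** (transpose V ** V) ** DI"
        by (simp add: root_W Diag_s_mult_Diag_s matrix_mul_assoc)
      also have "\<dots> = U ** Diag s ** (Diag s ** DI)" by (simp add: V matrix_mul_assoc)
      finally have A: "A = U ** Diag s + E ** (V ** DI)"
        by (simp add: A_def X'E matrix_add_rdistrib DIs matrix_mul_assoc)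
      \<comment> \<open>The first-order term in the norm of \<open>A\<close>: the factors
        \<open>Diag s\<close> and \<open>DI\<close> cancel, and \<open>root_UV\<close> identifies
        what is left as \<open>W \<bullet> (W' - W)\<close>.\<close>
      have "(E ** (V ** DI)) \<bullet> (U ** Diag s) = E \<bullet> (U ** (Diag s ** DI) ** transpose V)"
        by (simp add: inner_matrix_mult_right matrix_transpose_mul matrix_mul_assoc DI_def)
      also have "\<dots> = (root ** (U ** transpose V)) \<bullet> (W' - W)"
        unfolding DIs E_def inner_matrix_mult_left[of root "W' - W"] by (simp add: inner_commute)
      finally have "(E ** (V ** DI)) \<bullet> (U ** Diag s) = W \<bullet> (W' - W)" by (simp only: root_UV)
      then have "(norm A)\<^sup>2 = T + 2 * (W \<bullet> (W' - W)) + (norm (E ** (V ** DI)))\<^sup>2"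
        using norm_U_Diag_s
        by (simp add: A power2_norm_eq_inner inner_add inner_commute)
      moreover have "norm (E ** (V ** DI)) \<le> norm E * norm (V ** DI)" by (rule norm_matrix_mult_le)
      then have "norm (E ** (V ** DI)) \<le> K1 * \<delta>"
        using mult_right_mono[OF nE norm_ge_zero[of "V ** DI"]] by (simp add: K1_def mult_ac)
      then have "(norm (E ** (V ** DI)))\<^sup>2 \<le> (K1 * \<delta>)\<^sup>2" by (intro power_mono) auto
      ultimately show ?thesis by (simp add: power_mult_distrib)
    qed
    have "trace (psd_sqrt (X' ** transpose X')) \<le> ((norm A)\<^sup>2 + (norm B)\<^sup>2) / 2"
      unfolding AB by (rule trace_sqrt_product_le)
    then have "2 * trace (psd_sqrt (X' ** transpose X'))
        \<le> 2 * T + 2 * (W \<bullet> (W' - W)) + (K1\<^sup>2 + K2\<^sup>2) * \<delta>\<^sup>2"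
      using nA nB by (simp add: algebra_simps)
    \<comment> \<open>Expansion of the squared norm about \<open>W\<close>; the terms linear in
      \<open>W' - W\<close> now cancel.\<close>
    moreover have "(norm W')\<^sup>2 - 2 * (W \<bullet> (W' - W)) = \<delta>\<^sup>2 + T"
      using norm_W by (simp add: \<delta>_def power2_norm_eq_inner inner_diff inner_commute)
    ultimately show ?thesis
      unfolding bw_loss_Sig X'_def[symmetric] \<delta>_def[symmetric] using zero_le_power2[of \<delta>] by linarith
  qed
  show ?thesis using e low by (intro exI[of _ e] exI[of _ "K1\<^sup>2 + K2\<^sup>2"]) auto
qed

lemma bw_loss_critical_value: "bw_loss Sig W = trace Sig - T"
  using bw_loss_upper[of W] bw_loss_lower rank_W by force

lemma critical_point_W: "critical_point_on (bw_loss Sig) (rank_eq CARD('k)) W"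
proof -
  obtain e K where e: "0 < e" and low: "\<And>W'. rank W' = CARD('k) \<Longrightarrow> norm (W' - W) < e \<Longrightarrow>
     trace Sig - T - K * (norm (W' - W))\<^sup>2 \<le> bw_loss Sig W'" using bw_loss_lower by blast
  have "(bw_loss Sig has_derivative (\<lambda>_. 0)) (at W within rank_eq CARD('k))"
  proof (rule has_derivative_zero_of_quadratic[OF e])
    fix W' assume W': "W' \<in> rank_eq CARD('k)" "norm (W' - W) < e"
    have "K * (norm (W' - W))\<^sup>2 \<le> (1 + \<bar>K\<bar>) * (norm (W' - W))\<^sup>2" "(norm (W' - W))\<^sup>2 \<le> (1 + \<bar>K\<bar>) * (norm (W' - W))\<^sup>2"
      by (auto intro!: mult_right_mono simp: mult_le_cancel_right1)
    then show "\<bar>bw_loss Sig W' - bw_loss Sig W\<bar> \<le> (1 + \<bar>K\<bar>) * (norm (W' - W))\<^sup>2"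
      using low[of W'] bw_loss_upper[of W'] bw_loss_critical_value W' by (simp add: rank_eq_def)
  qed
  then show ?thesis using rank_W by (auto simp: critical_point_on_def rank_eq_def)
qed

lemma W_eq: "W = select_columns Om h ** Diag (\<lambda>a. sqrt (lam (h a))) ** transpose V"
  by (simp add: W_def U_def s_def)

end

context bures_wasserstein_target
begin

theorem select_columns_critical:
  fixes h :: "'k::finite \<Rightarrow> 'n" and V :: "real^'k^'m::finite"
  assumes "inj h" "transpose V ** V = mat 1"
  defines "Z \<equiv> select_columns Om h ** Diag (\<lambda>a. sqrt (lam (h a))) ** transpose V"
  shows "rank Z = CARD('k)"
    and "critical_point_on (bw_loss Sig) (rank_eq CARD('k)) Z"
    and "bw_loss Sig Z = trace Sig - (\<Sum>a\<in>UNIV. lam (h a))"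
proof -
  interpret selected_columns Om lam h V
    by unfold_locales (use assms in auto)
  show "rank Z = CARD('k)" "critical_point_on (bw_loss Sig) (rank_eq CARD('k)) Z"
    "bw_loss Sig Z = trace Sig - (\<Sum>a\<in>UNIV. lam (h a))"
    unfolding Z_def W_eq[symmetric] T_def[symmetric]
    by (rule rank_W critical_point_W bw_loss_critical_value)+
qed

end

section \<open>Stationarity and minimality\<close>

text \<open>For small \<open>t\<close> the matrix \<open>mat 1 + t *\<^sub>R A\<close> is
  invertible, so the line through \<open>W\<close> in direction \<open>A ** W\<close> keeps the
  rank.\<close>

lemma tangent_vector_left_mult:
  fixes W :: "real^'m^'n" and A :: "real^'n^'n"
  assumes W: "W \<in> rank_eq k"
  obtains e where "0 < e" "\<And>t. t \<in> {-e<..<e} \<Longrightarrow> W + t *\<^sub>R (A ** W) \<in> rank_eq k"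
    "A ** W \<in> tangent_vectors (rank_eq k) W"
proof -
  define e where "e = 1 / (norm A + 1)"
  have e: "0 < e" by (simp add: e_def add_nonneg_pos)
  have rk: "W + t *\<^sub>R (A ** W) \<in> rank_eq k" if t: "t \<in> {-e<..<e}" for t
  proof -
    have ta: "\<bar>t\<bar> * norm A < 1"
    proof -
      have "\<bar>t\<bar> * norm A \<le> e * norm A" using t by (intro mult_right_mono) auto
      also have "\<dots> < 1" by (simp add: e_def divide_simps add_nonneg_pos)
      finally show ?thesis .
    qed
    have "inj ((*v) (mat 1 + t *\<^sub>R A))"
    proof (rule left_mult_inj_if_bounded_below)
      fix x
      have "norm ((t *\<^sub>R A) *v x) \<le> \<bar>t\<bar> * norm A * norm x"
        using norm_matrix_vector_le[of "t *\<^sub>R A" x] by simp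
      moreover have "norm x \<le> norm ((mat 1 + t *\<^sub>R A) *v x) + norm ((t *\<^sub>R A) *v x)"
        using norm_triangle_ineq4[of "(mat 1 + t *\<^sub>R A) *v x" "(t *\<^sub>R A) *v x"]
        by (simp add: matrix_vector_mult_add_rdistrib)
      ultimately show "(1 - \<bar>t\<bar> * norm A) * norm x \<le> norm ((mat 1 + t *\<^sub>R A) *v x)"
        by (simp add: algebra_simps)
    qed (use ta in simp)
    then have "invertible (mat 1 + t *\<^sub>R A)"
      using matrix_left_invertible_injective invertible_left_inverse by blast
    moreover have "W + t *\<^sub>R (A ** W) = (mat 1 + t *\<^sub>R A) ** W"
      by (simp add: matrix_add_rdistrib scalar_matrix_assoc)
    ultimately show ?thesis using W by (simp add: rank_eq_def rank_mult_left_cancel)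
  qed
  \<comment> \<open>The sequence of derivatives of an affine curve: zero from the second one
    on.\<close>
  define G :: "nat \<Rightarrow> real \<Rightarrow> real^'m^'n" where
    "G i t = (if i = 0 then W + t *\<^sub>R (A ** W) else if i = 1 then A ** W else 0)" for i t
  have "(G i has_vector_derivative G (Suc i) t) (at t)" for i t
  proof -
    have "i = 0 \<or> i = 1 \<or> i > 1" by auto
    then show ?thesis by (auto simp: G_def[abs_def] intro!: derivative_eq_intros)
  qed
  then have "A ** W \<in> tangent_vectors (rank_eq k) W"
    unfolding tangent_vectors_def using e rk by (auto intro!: exI[of _ G] exI[of _ e] simp: G_def)
  with e rk that show ?thesis by blast
qed

text \<open>The scalar core of Ky Fan's inequality. A threshold \<open>\<mu>\<close> separates the
  weights in \<open>J\<close> from the others, and the defect splits into three nonnegative terms.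
  In the equality case the strict gap off \<open>J\<close> forces \<open>p\<close> to vanish there,
  and positivity of the weights then forces \<open>p = 1\<close> on \<open>J\<close>.\<close>

lemma weighted_sum_le_top:
  fixes w p :: "'a::finite \<Rightarrow> real"
  assumes p: "\<And>i. 0 \<le> p i" "\<And>i. p i \<le> 1" and sum_p: "(\<Sum>i\<in>UNIV. p i) \<le> card J"
    and w: "\<And>i. 0 < w i" and top: "\<And>i j. i \<in> J \<Longrightarrow> j \<notin> J \<Longrightarrow> w j < w i"
  shows "(\<Sum>i\<in>UNIV. w i * p i) \<le> (\<Sum>i\<in>J. w i)"
    and "(\<Sum>i\<in>UNIV. w i * p i) = (\<Sum>i\<in>J. w i) \<Longrightarrow> p i = (if i \<in> J then 1 else 0)"
proof -
  \<comment> \<open>For empty \<open>J\<close> any nonnegative number above all weights serves;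
    \<open>Min\<close> would be taken over the empty set.\<close>
  define \<mu> where "\<mu> = (if J = {} then Max (range w) + 1 else Min (w ` J))"
  have mu_J: "\<mu> \<le> w i" if "i \<in> J" for i using that by (auto simp: \<mu>_def)
  have mu_nJ: "w j < \<mu>" if j: "j \<notin> J" for j
  proof (cases "J = {}")
    case True
    have "w j \<le> Max (range w)" by simp
    then have "w j < Max (range w) + 1" by linarith
    then show ?thesis using True by (simp add: \<mu>_def)
  qed (use top[OF _ j] in \<open>simp add: \<mu>_def\<close>)
  have mu0: "0 \<le> \<mu>"
  proof (cases "J = {}")
    case True
    have "w undefined \<le> Max (range w)" by simp
    then have "0 \<le> Max (range w) + 1" using w[of undefined] by linarith
    then show ?thesis using True by (simp add: \<mu>_def)
  next
    case False
    then show ?thesis using w by (simp add: \<mu>_def less_imp_le)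
  qed
  have split: "(\<Sum>i\<in>UNIV. g i) = (\<Sum>i\<in>J. g i) + (\<Sum>i\<in>-J. g i)" for g :: "'a \<Rightarrow> real"
    using sum.subset_diff[of J UNIV g] by (simp add: Compl_eq_Diff_UNIV)
  have id: "(\<Sum>i\<in>J. w i) - (\<Sum>i\<in>UNIV. w i * p i)
      = (\<Sum>i\<in>J. (w i - \<mu>) * (1 - p i)) + \<mu> * (card J - (\<Sum>i\<in>UNIV. p i)) + (\<Sum>i\<in>-J. (\<mu> - w i) * p i)"
    unfolding split by (simp add: algebra_simps sum.distrib sum_subtractf sum_distrib_left)
  have n1: "0 \<le> (\<Sum>i\<in>J. (w i - \<mu>) * (1 - p i))"
    using mu_J p by (intro sum_nonneg mult_nonneg_nonneg) auto
  have n2: "0 \<le> \<mu> * (card J - (\<Sum>i\<in>UNIV. p i))" using mu0 sum_p by simp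
  have nn: "0 \<le> (\<mu> - w i) * p i" if "i \<in> - J" for i using mu_nJ[of i] p that by simp
  then have n3: "0 \<le> (\<Sum>i\<in>-J. (\<mu> - w i) * p i)" by (rule sum_nonneg)
  show "(\<Sum>i\<in>UNIV. w i * p i) \<le> (\<Sum>i\<in>J. w i)" using id n1 n2 n3 by linarith
  assume eq: "(\<Sum>i\<in>UNIV. w i * p i) = (\<Sum>i\<in>J. w i)"
  then have "(\<Sum>i\<in>-J. (\<mu> - w i) * p i) = 0" using id n1 n2 n3 by linarith
  then have "\<forall>i\<in>-J. (\<mu> - w i) * p i = 0" using nn by (subst (asm) sum_nonneg_eq_0_iff) auto
  then have pz: "p j = 0" if "j \<notin> J" for j using mu_nJ[OF that] that by auto
  have "(\<Sum>i\<in>J. w i * (1 - p i)) = 0"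
    using eq pz unfolding split by (simp add: algebra_simps sum_subtractf)
  moreover have "0 \<le> w i * (1 - p i)" for i using w[of i] p[of i] by simp
  ultimately have "\<forall>i\<in>J. w i * (1 - p i) = 0" by (subst (asm) sum_nonneg_eq_0_iff) auto
  then have "p j = 1" if "j \<in> J" for j using w[of j] that by auto
  with pz show "p i = (if i \<in> J then 1 else 0)" by simp
qed

lemma conjugate_Diag_inj:
  fixes U :: "real^'n^'n"
  assumes U: "orthogonal_matrix U" and eq: "U ** Diag d ** transpose U = U ** Diag e ** transpose U"
  shows "d = e"
proof -
  have "Diag c = transpose U ** (U ** Diag c ** transpose U) ** U" for c
    using U by (simp add: orthogonal_matrix_def matrix_mul_assoc)
       (simp add: orthogonal_matrix_def flip: matrix_mul_assoc)
  then have "Diag d = Diag e" using eq by metis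
  moreover have "Diag c $ i $ i = c i" for c :: "'n \<Rightarrow> real" and i by (simp add: Diag_def)
  ultimately show ?thesis by (metis ext)
qed

context bures_wasserstein_target
begin

text \<open>Along a curve in the manifold, majorant minus loss is nonnegative and zero at
  \<open>W\<close>, so its derivative there is zero. The loss contributes nothing by criticality,
  hence the derivative of the majorant vanishes as well.\<close>

lemma critical_point_stationary:
  fixes W :: "real^'m^'n"
  assumes crit: "critical_point_on (bw_loss Sig) (rank_eq k) W"
    and Q: "contraction Q" "Q ** transpose (root ** W) = psd_sqrt ((root ** W) ** transpose (root ** W))"
  shows "(W - root ** Q) ** transpose W = 0"
proof -
  obtain D where W: "W \<in> rank_eq k" and D: "(bw_loss Sig has_derivative D) (at W within rank_eq k)"
    and D0: "\<And>v. v \<in> tangent_vectors (rank_eq k) W \<Longrightarrow> D v = 0"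
    using crit by (auto simp: critical_point_on_def)
  define R where "R = W - root ** Q"
  \<comment> \<open>For this direction the derivative of the majorant is twice the squared norm of
    \<open>A\<close>, so its vanishing gives the whole matrix equation at once.\<close>
  define A where "A = R ** transpose W"
  define v where "v = A ** W"
  obtain e where e: "0 < e" and rk: "\<And>t. t \<in> {-e<..<e} \<Longrightarrow> W + t *\<^sub>R v \<in> rank_eq k"
    and tv: "v \<in> tangent_vectors (rank_eq k) W"
    using tangent_vector_left_mult[OF W, of A] unfolding v_def by blast
  have lin: "linear D" using D has_derivative_linear by blast
  have "((\<lambda>t. W + t *\<^sub>R v) has_derivative (\<lambda>t. t *\<^sub>R v)) (at 0 within {-e<..<e})"
    by (auto intro!: derivative_eq_intros)
  moreover have "(bw_loss Sig has_derivative D) (at (W + 0 *\<^sub>R v) within (\<lambda>t. W + t *\<^sub>R v) ` {-e<..<e})"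
    using has_derivative_subset[OF D, of "(\<lambda>t. W + t *\<^sub>R v) ` {-e<..<e}"] rk
    by (simp add: image_subset_iff)
  ultimately have "((\<lambda>t. bw_loss Sig (W + t *\<^sub>R v)) has_derivative (\<lambda>t. D (t *\<^sub>R v))) (at 0 within {-e<..<e})"
    using diff_chain_within[of "\<lambda>t. W + t *\<^sub>R v" "\<lambda>t. t *\<^sub>R v" 0 "{-e<..<e}" "bw_loss Sig" D] by (simp add: comp_def)
  then have dL: "((\<lambda>t. bw_loss Sig (W + t *\<^sub>R v)) has_derivative (\<lambda>t. 0)) (at 0)"
    using e D0[OF tv] by (simp add: linear_scale[OF lin] at_within_open[of 0 "{-e<..<e}"])
  have dm: "((\<lambda>t. majorant Q (W + t *\<^sub>R v)) has_derivative (\<lambda>t. t * (2 * (R \<bullet> v)))) (at 0)"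
    unfolding majorant_def power2_norm_eq_inner R_def
    by (auto intro!: derivative_eq_intros simp: inner_diff inner_commute algebra_simps)
  have "(\<lambda>t. t * (2 * (R \<bullet> v)) - 0) = (\<lambda>t. 0)"
  proof (rule has_derivative_local_min)
    show "((\<lambda>t. majorant Q (W + t *\<^sub>R v) - bw_loss Sig (W + t *\<^sub>R v)) has_derivative (\<lambda>t. t * (2 * (R \<bullet> v)) - 0)) (at 0)"
      by (rule has_derivative_diff[OF dm dL])
    have "0 \<le> majorant Q Y - bw_loss Sig Y" for Y using bw_loss_le_majorant[OF Q(1)] by simp
    then show "\<forall>\<^sub>F t in at 0. majorant Q (W + 0 *\<^sub>R v) - bw_loss Sig (W + 0 *\<^sub>R v)
       \<le> majorant Q (W + t *\<^sub>R v) - bw_loss Sig (W + t *\<^sub>R v)"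
      using bw_loss_eq_majorant[OF Q(2)] by simp
  qed
  from fun_cong[OF this, of 1] have "R \<bullet> v = 0" by simp
  moreover have "R \<bullet> v = A \<bullet> A"
    unfolding v_def inner_commute[of R] inner_matrix_mult_right A_def[symmetric] ..
  ultimately have "A \<bullet> A = 0" by simp
  then show ?thesis by (simp add: A_def R_def)
qed

text \<open>In the eigenbasis, commutation says that entry \<open>i\<close>, \<open>j\<close> is
  multiplied equally by \<open>lam i\<close> and \<open>lam j\<close>; distinct eigenvalues leave
  only the diagonal.\<close>

lemma commutes_with_Sig:
  assumes "P ** Sig = Sig ** P"
  obtains p where "P = Om ** Diag p ** transpose Om"
proof -
  define P' where "P' = transpose Om ** P ** Om"
  have P: "P = Om ** P' ** transpose Om"
    by (simp add: P'_def matrix_mul_assoc Om_mult) (simp add: Om_mult flip: matrix_mul_assoc)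
  have "P' ** Diag lam = transpose Om ** (P ** Sig) ** Om"
    by (simp add: P'_def Sig_def matrix_mul_assoc) (simp add: Om_mult flip: matrix_mul_assoc)
  also have "\<dots> = Diag lam ** P'"
    unfolding assms by (simp add: P'_def Sig_def matrix_mul_assoc Om_mult)
  finally have c: "P' $ i $ j * lam j = lam i * P' $ i $ j" for i j
    by (metis Diag_mult_left Diag_mult_right)
  have "P' $ i $ j = 0" if "i \<noteq> j" for i j
    using c[of i j] lam_inj that by (auto simp: inj_eq mult.commute)
  then have "P' = Diag (\<lambda>i. P' $ i $ i)" by (simp add: vec_eq_iff Diag_def)
  with P that show ?thesis by metis
qed

lemma critical_point_gram:
  fixes W :: "real^'m^'n"
  assumes crit: "critical_point_on (bw_loss Sig) (rank_eq k) W"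
  obtains J where "card J = k" "W ** transpose W = Om ** Diag (\<lambda>i. if i \<in> J then lam i else 0) ** transpose Om"
proof -
  define X where "X = root ** W"
  define P where "P = psd_sqrt (X ** transpose X)"
  define K where "K = W ** transpose W"
  obtain Q where Q: "contraction Q" "Q ** transpose X = P" "pos_semidef P" "P ** P = X ** transpose X" "P ** Q = X"
    unfolding P_def using polar_factor_exists[of X] by blast
  have "K = root ** Q ** transpose W"
    using critical_point_stationary[OF crit, of Q] Q unfolding X_def P_def K_def
    by (simp add: matrix_diff_rdistrib)
  moreover have "Q ** (transpose W ** root) = P" using Q(2) by (simp add: X_def matrix_transpose_mul)
  ultimately have Kr: "K ** root = root ** P" by (simp flip: matrix_mul_assoc)
  have sP: "transpose P = P" using Q by (simp add: pos_semidef_def)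
  have sK: "transpose K = K" by (simp add: K_def matrix_transpose_mul)
  \<comment> \<open>The transpose of \<open>Kr\<close>; combined with it, \<open>P ** Sig\<close>
    and \<open>Sig ** P\<close> both become \<open>root ** K ** root\<close>.\<close>
  have rK: "root ** K = P ** root"
    using arg_cong[OF Kr, of transpose] by (simp add: matrix_transpose_mul sP sK)
  have "P ** Sig = root ** K ** root" unfolding rK by (simp add: root_root flip: matrix_mul_assoc)
  also have "\<dots> = Sig ** P" using Kr by (metis matrix_mul_assoc root_root)
  finally obtain p where p: "P = Om ** Diag p ** transpose Om" by (rule commutes_with_Sig)
  have comm: "P ** root = root ** P"
    unfolding p root_def conjugate_Diag_mult[OF Om_mult(1)] by (simp add: mult.commute)
  obtain ri where ri: "root ** ri = mat 1" using invertible_root by (auto simp: invertible_def)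
  \<comment> \<open>Once \<open>P\<close> commutes with \<open>root\<close>, the invertible
    \<open>root\<close> cancels from \<open>Kr\<close>.\<close>
  have "K = K ** root ** ri" by (simp add: ri flip: matrix_mul_assoc)
  also have "\<dots> = P" unfolding Kr comm[symmetric] by (simp add: ri flip: matrix_mul_assoc)
  finally have KP: "K = P" .
  have "P ** P = Sig ** P"
  proof -
    have "P ** P = root ** K ** root" by (simp add: Q X_def K_def matrix_transpose_mul matrix_mul_assoc)
    also have "\<dots> = root ** root ** P" using comm KP by (simp flip: matrix_mul_assoc)
    finally show ?thesis by (simp add: root_root)
  qed
  then have "(\<lambda>i. p i * p i) = (\<lambda>i. lam i * p i)"
    unfolding p Sig_def conjugate_Diag_mult[OF Om_mult(1)] by (rule conjugate_Diag_inj[OF Om])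
  then have pp: "p i = 0 \<or> p i = lam i" for i by (metis mult_right_cancel)
  define J where "J = {i. p i \<noteq> 0}"
  have pJ: "p = (\<lambda>i. if i \<in> J then lam i else 0)"
  proof
    show "p i = (if i \<in> J then lam i else 0)" for i using pp[of i] by (auto simp: J_def)
  qed
  have "rank P = card J" unfolding p J_def by (rule rank_conjugate_Diag[OF Om])
  moreover have "rank P \<le> rank W" unfolding KP[symmetric] K_def by (rule rank_mul_le_left)
  \<comment> \<open>Uses \<open>root ** W = P ** Q\<close> with \<open>root\<close> invertible; so
    \<open>J\<close> has exactly \<open>k\<close> elements.\<close>
  moreover have "rank W \<le> rank P"
    using rank_mul_le_left[of P Q] rank_mult_left_cancel[OF invertible_root, of W] by (simp add: Q X_def)
  moreover have "rank W = k" using crit by (simp add: critical_point_on_def rank_eq_def)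
  ultimately have "card J = k" by simp
  then show ?thesis using that KP p pJ by (simp add: K_def)
qed

text \<open>The Gram matrix fixes \<open>W\<close> up to the right factor, and orthonormality of
  \<open>U\<close> leaves only one candidate for \<open>V\<close>, namely
  \<open>transpose W ** U ** I\<close>. Its columns are orthonormal by the prescribed Gram matrix,
  and \<open>W\<close> is recovered because its columns lie in the span of \<open>U\<close>.\<close>

lemma gram_determines_factor:
  fixes W :: "real^'m^'n" and h :: "'k::finite \<Rightarrow> 'n"
  assumes h: "inj h" and K: "W ** transpose W = Om ** Diag (\<lambda>i. if i \<in> range h then lam i else 0) ** transpose Om"
  obtains V :: "real^'k^'m" where "transpose V ** V = mat 1"
    "W = select_columns Om h ** Diag (\<lambda>a. sqrt (lam (h a))) ** transpose V"
proof -
  define U where "U = select_columns Om h"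
  define I where "I = Diag (\<lambda>a. 1 / sqrt (lam (h a)))"
  define V where "V = transpose W ** U ** I"
  have tI: "transpose I = I" by (simp add: I_def)
  have UU: "transpose U ** U = mat 1" unfolding U_def by (rule select_columns_orthonormal[OF Om h])
  have sq: "sqrt (lam (h a)) * sqrt (lam (h a)) = lam (h a)" "sqrt (lam (h a)) \<noteq> 0" for a
    using lam_pos[of "h a"] by auto
  have KU: "W ** transpose W ** U = U ** Diag (\<lambda>a. lam (h a))"
    unfolding K U_def conjugate_Diag_select_columns[OF Om] by simp
  have "transpose V ** V = I ** transpose U ** (W ** transpose W ** U) ** I"
    by (simp add: V_def matrix_transpose_mul tI matrix_mul_assoc)
  also have "\<dots> = I ** (transpose U ** U) ** Diag (\<lambda>a. lam (h a)) ** I"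
    unfolding KU by (simp add: matrix_mul_assoc)
  also have "\<dots> = Diag (\<lambda>a. 1 / sqrt (lam (h a)) * lam (h a) * (1 / sqrt (lam (h a))))"
    unfolding UU by (simp only: matrix_mul_rid I_def Diag_mult)
  also have "(\<lambda>a. 1 / sqrt (lam (h a)) * lam (h a) * (1 / sqrt (lam (h a)))) = (\<lambda>a. 1)"
    using sq by (simp add: fun_eq_iff field_simps)
  finally have VV: "transpose V ** V = mat 1" by (simp add: Diag_1)
  define N where "N = U ** transpose U"
  have N: "N = Om ** Diag (\<lambda>i. if i \<in> range h then 1 else 0) ** transpose Om"
    using select_columns_conjugate_Diag[OF h, of Om "\<lambda>_. 1"] by (simp add: N_def U_def Diag_1)
  have "(\<lambda>i. (if i \<in> range h then 1 else 0) * (if i \<in> range h then lam i else 0)) = (\<lambda>i. if i \<in> range h then lam i else 0)"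
    by auto
  then have NK: "N ** (W ** transpose W) = W ** transpose W"
    unfolding N K conjugate_Diag_mult[OF Om_mult(1)] by simp
  \<comment> \<open>The squared distance of \<open>W\<close> from its projection is a pairing with
    \<open>(W - N ** W) ** transpose W\<close>, which vanishes since \<open>N\<close> fixes the Gram
    matrix.\<close>
  have "(W - N ** W) \<bullet> (W - N ** W) = (mat 1 - N) \<bullet> ((W - N ** W) ** transpose W)"
    using inner_matrix_mult_right[of "mat 1 - N" W "W - N ** W"] by (simp add: matrix_diff_rdistrib)
  also have "(W - N ** W) ** transpose W = 0"
    using NK by (simp add: matrix_diff_rdistrib matrix_mul_assoc)
  finally have "W = N ** W" by simp
  also have "\<dots> = U ** (Diag (\<lambda>a. sqrt (lam (h a))) ** I) ** (transpose U ** W)"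
    using sq by (simp add: N_def I_def Diag_mult Diag_1 matrix_mul_assoc)
  also have "\<dots> = U ** Diag (\<lambda>a. sqrt (lam (h a))) ** transpose V"
    by (simp add: V_def matrix_transpose_mul tI matrix_mul_assoc)
  finally show ?thesis using that VV unfolding U_def by blast
qed

text \<open>At the polar factor \<open>Q\<close> the loss equals its majorant, which is at least
  \<open>trace Sig\<close> minus the squared norm of \<open>root ** Q\<close>. That norm is the sum
  of \<open>lam\<close> weighted by the diagonal of the projection \<open>Q ** transpose Q\<close>
  in the eigenbasis, so \<open>weighted_sum_le_top\<close> applies. Equality forces
  \<open>W = root ** Q\<close> and fixes the projection.\<close>

lemma bw_loss_rank_le:
  fixes W :: "real^'m^'n"
  assumes rk: "rank W \<le> card J" and top: "\<And>i j. i \<in> J \<Longrightarrow> j \<notin> J \<Longrightarrow> lam j < lam i"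
  shows "trace Sig - (\<Sum>i\<in>J. lam i) \<le> bw_loss Sig W"
    and "bw_loss Sig W = trace Sig - (\<Sum>i\<in>J. lam i) \<Longrightarrow>
      W ** transpose W = Om ** Diag (\<lambda>i. if i \<in> J then lam i else 0) ** transpose Om"
proof -
  obtain Q where Q: "Q ** transpose (root ** W) = psd_sqrt ((root ** W) ** transpose (root ** W))"
    and idem: "(Q ** transpose Q) ** (Q ** transpose Q) = Q ** transpose Q"
    and tr: "trace (Q ** transpose Q) \<le> rank (root ** W)"
    using polar_factor_exists[of "root ** W"] by blast
  define N where "N = transpose Om ** (Q ** transpose Q) ** Om"
  have sN: "transpose N = N" by (simp add: N_def matrix_transpose_mul matrix_mul_assoc)
  have QN: "Q ** transpose Q = Om ** N ** transpose Om"
    by (simp add: N_def matrix_mul_assoc Om_mult) (simp add: Om_mult flip: matrix_mul_assoc)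
  have NN: "N ** N = N"
  proof -
    have "N ** N = transpose Om ** (Q ** transpose Q) ** (Om ** transpose Om) ** (Q ** transpose Q) ** Om"
      by (simp add: N_def matrix_mul_assoc)
    also have "\<dots> = transpose Om ** ((Q ** transpose Q) ** (Q ** transpose Q)) ** Om"
      by (simp add: Om_mult matrix_mul_assoc)
    finally show ?thesis unfolding idem N_def .
  qed
  \<comment> \<open>For a symmetric idempotent a diagonal entry is the squared norm of its row,
    hence lies between 0 and 1.\<close>
  have diag: "N $ i $ i = (norm (N $ i))\<^sup>2" for i
  proof -
    have "N $ i $ i = (N ** transpose N) $ i $ i" by (simp add: sN NN)
    also have "\<dots> = N $ i \<bullet> N $ i"
      unfolding matrix_matrix_mult_def transpose_def inner_vec_def by simp
    finally show ?thesis by (simp add: power2_norm_eq_inner)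
  qed
  have le1: "N $ i $ i \<le> 1" for i
  proof -
    have "(N $ i $ i)\<^sup>2 \<le> (norm (N $ i))\<^sup>2"
      using component_le_norm_cart[of "N $ i" i] by (simp add: abs_le_square_iff[symmetric])
    then have "N $ i $ i * N $ i $ i \<le> 1 * N $ i $ i" using diag[of i] by (simp add: power2_eq_square)
    then show ?thesis by (rule le_of_mult_self_le) (simp_all add: diag[of i])
  qed
  have "trace N = trace (Q ** transpose Q)"
    unfolding N_def by (subst trace_mul_sym) (simp add: matrix_mul_assoc Om_mult)
  then have sum: "(\<Sum>i\<in>UNIV. N $ i $ i) \<le> card J"
    using tr rk by (simp add: trace_def rank_mult_left_cancel[OF invertible_root])
  have "(norm (root ** Q))\<^sup>2 = trace (Diag lam ** N)"
  proof -
    have "(norm (root ** Q))\<^sup>2 = trace (root ** (Q ** transpose Q ** root))"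
      by (simp add: norm_matrix_sq(1) matrix_transpose_mul matrix_mul_assoc)
    also have "\<dots> = trace (Q ** transpose Q ** (root ** root))"
      by (subst trace_mul_sym) (simp add: matrix_mul_assoc)
    also have "\<dots> = trace (Om ** (N ** Diag lam ** transpose Om))"
      unfolding root_root QN Sig_def by (simp add: matrix_mul_assoc) (simp add: Om_mult flip: matrix_mul_assoc)
    also have "\<dots> = trace (N ** Diag lam)"
      by (subst trace_mul_sym) (simp add: Om_mult flip: matrix_mul_assoc)
    also have "\<dots> = trace (Diag lam ** N)" by (rule trace_mul_sym)
    finally show ?thesis .
  qed
  then have nQ: "(norm (root ** Q))\<^sup>2 = (\<Sum>i\<in>UNIV. lam i * N $ i $ i)"
    by (simp add: trace_def Diag_mult_left)
  note ky_fan = weighted_sum_le_top[of "\<lambda>i. N $ i $ i" J lam, OF _ le1 sum lam_pos top]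
  have L: "bw_loss Sig W = (norm (W - root ** Q))\<^sup>2 + trace Sig - (\<Sum>i\<in>UNIV. lam i * N $ i $ i)"
    using bw_loss_eq_majorant[OF Q] by (simp add: majorant_square nQ)
  have le: "(\<Sum>i\<in>UNIV. lam i * N $ i $ i) \<le> (\<Sum>i\<in>J. lam i)"
    by (rule ky_fan(1)) (simp_all add: diag)
  show "trace Sig - (\<Sum>i\<in>J. lam i) \<le> bw_loss Sig W"
    unfolding L using le zero_le_power2[of "norm (W - root ** Q)"] by linarith
  assume eq: "bw_loss Sig W = trace Sig - (\<Sum>i\<in>J. lam i)"
  then have "(norm (W - root ** Q))\<^sup>2 = 0" and eq': "(\<Sum>i\<in>UNIV. lam i * N $ i $ i) = (\<Sum>i\<in>J. lam i)"
    using le zero_le_power2[of "norm (W - root ** Q)"] unfolding L by linarith+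
  then have W: "W = root ** Q" by simp
  have Ni: "N $ i $ i = (if i \<in> J then 1 else 0)" for i
    by (rule ky_fan(2)) (simp_all add: diag eq'[unfolded diag])
  \<comment> \<open>A row of norm 1 with diagonal entry 1 is a standard unit vector; a row of norm 0
    is zero.\<close>
  have "N $ i = (if i \<in> J then axis i 1 else 0)" for i
  proof (cases "i \<in> J")
    case True
    have "(norm (N $ i - axis i 1))\<^sup>2 = (norm (N $ i))\<^sup>2 - 2 * N $ i $ i + 1"
      by (simp add: power2_norm_eq_inner inner_diff inner_axis inner_axis')
    then show ?thesis using True Ni[of i] diag[of i] by simp
  next
    case False
    then show ?thesis using Ni[of i] diag[of i] by simp
  qed
  then have "N = Diag (\<lambda>i. if i \<in> J then 1 else 0)" by (simp add: vec_eq_iff Diag_def axis_def)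
  then have "Q ** transpose Q = Om ** Diag (\<lambda>i. if i \<in> J then 1 else 0) ** transpose Om" by (simp add: QN)
  moreover have "W ** transpose W = root ** (Q ** transpose Q) ** root"
    by (simp add: W matrix_transpose_mul matrix_mul_assoc)
  moreover have "(\<lambda>i. sqrt (lam i) * (if i \<in> J then 1 else 0) * sqrt (lam i)) = (\<lambda>i. if i \<in> J then lam i else 0)"
    using lam_pos by (auto simp: less_imp_le)
  ultimately show "W ** transpose W = Om ** Diag (\<lambda>i. if i \<in> J then lam i else 0) ** transpose Om"
    by (simp only: root_def conjugate_Diag_mult[OF Om_mult(1)])
qed

end

section \<open>Translation of the hypotheses and assembly\<close>

lemma orthogonal_transpose_mult_nonzero:
  fixes U :: "real^'n^'n"
  assumes "orthogonal_matrix U" "x \<noteq> 0"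
  shows "transpose U *v x \<noteq> 0"
proof
  assume "transpose U *v x = 0"
  then have "U *v (transpose U *v x) = 0" by simp
  then have "(U ** transpose U) *v x = 0" by (simp only: matrix_vector_mul_assoc)
  then show False using assms by (simp add: orthogonal_matrix_def)
qed

text \<open>Combined with the count of eigenvalues, this makes the diagonal entries pairwise
  distinct.\<close>

lemma eigenvalues_conjugate_Diag:
  fixes U :: "real^'n^'n"
  assumes U: "orthogonal_matrix U"
  shows "eigenvalues (U ** Diag d ** transpose U) \<subseteq> range d"
proof
  fix c assume "c \<in> eigenvalues (U ** Diag d ** transpose U)"
  then obtain x where x: "x \<noteq> 0" "(U ** Diag d ** transpose U) *v x = c *\<^sub>R x"
    by (auto simp: eigenvalues_def)
  define y where "y = transpose U *v x"
  have "y \<noteq> 0" unfolding y_def by (rule orthogonal_transpose_mult_nonzero[OF U x(1)])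
  then obtain i where i: "y $ i \<noteq> 0" by (auto simp: vec_eq_iff)
  have "transpose U ** (U ** Diag d ** transpose U) = Diag d ** transpose U"
    using U by (simp add: orthogonal_matrix_def matrix_mul_assoc)
  then have "Diag d *v y = transpose U *v ((U ** Diag d ** transpose U) *v x)"
    unfolding y_def by (simp only: matrix_vector_mul_assoc)
  also have "\<dots> = c *\<^sub>R y" unfolding x(2) y_def by (rule matrix_vector_mult_scaleR)
  finally have "(Diag d *v y) $ i = c * y $ i" by simp
  then have "d i * y $ i = c * y $ i" by (simp add: Diag_vec)
  then have "c = d i" using i by simp
  then show "c \<in> range d" by blast
qed

lemma pos_def_conjugate_Diag:
  fixes U :: "real^'n^'n"
  assumes U: "orthogonal_matrix U" and pd: "pos_def (U ** Diag d ** transpose U)"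
  shows "0 < d i"
proof -
  have n: "norm (column i U) = 1" by (rule column_orthogonal_unit[OF U])
  then have "column i U \<noteq> 0" by auto
  then have "0 < column i U \<bullet> ((U ** Diag d ** transpose U) *v column i U)"
    using pd unfolding pos_def_def by blast
  then show ?thesis using n by (simp add: conjugate_Diag_eigenvector[OF U] flip: power2_norm_eq_inner)
qed

text \<open>Supplies a \<open>V\<close>, built from distinct standard unit vectors, so that the
  minimum is attained.\<close>

lemma orthonormal_columns_exist:
  assumes "CARD('k::finite) \<le> CARD('m::finite)"
  obtains V :: "real^'k^'m" where "transpose V ** V = mat 1"
proof -
  obtain f :: "'k \<Rightarrow> 'm" where f: "inj f"
    using inj_on_iff_card_le[of "UNIV :: 'k set" "UNIV :: 'm set"] assms by auto
  have "transpose (select_columns (mat 1 :: real^'m^'m) f) ** select_columns (mat 1) f = mat 1"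
    by (rule select_columns_orthonormal[OF orthogonal_matrix_id f])
  then show ?thesis using that by blast
qed

theorem theorem4p2:
  fixes \<Sigma> \<Omega> :: "real ^ 'n::{finite,linorder} ^ 'n::{finite,linorder}"
    and lam :: "'n \<Rightarrow> real"
    and L :: "real ^ 'm::finite ^ 'n::{finite,linorder} \<Rightarrow> real"
    and k :: nat
    and crit :: "'n set \<Rightarrow> real ^ 'k::{finite,linorder} ^ 'm::finite \<Rightarrow> real ^ 'm ^ 'n::{finite,linorder}"
  assumes "pos_def \<Sigma>"
    and "card (eigenvalues \<Sigma>) = CARD('n)"
    and "orthogonal_matrix \<Omega>"
    and "\<Sigma> = \<Omega> ** Diag lam ** transpose \<Omega>"
    and "antimono lam"
    and "k = CARD('k)"
    and "k \<le> min CARD('n) CARD('m)"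
  defines "L \<equiv> bw_loss \<Sigma>"
    and "crit \<equiv> \<lambda>J V. col_submatrix \<Omega> J ** psd_sqrt (principal_submatrix (Diag lam) J) ** transpose V"
  shows "(\<forall>W\<in>rank_eq k. critical_point_on L (rank_eq k) W \<longleftrightarrow>
            (\<exists>J V. card J = k \<and> transpose V ** V = mat 1 \<and> W = crit J V)) \<and>
         {W. is_arg_min L (\<lambda>W. W \<in> rank_le k) W} =
            {crit (first_indices k) V |V. transpose V ** V = mat 1} \<and>
         (\<exists>W\<^sub>1 W\<^sub>2. is_arg_min L (\<lambda>W. W \<in> rank_eq k) W\<^sub>1 \<and> (INF W\<in>rank_eq k. L W) = L W\<^sub>1 \<and>
            is_arg_min L (\<lambda>W. W \<in> rank_le k) W\<^sub>2 \<and> L W\<^sub>1 = L W\<^sub>2)"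
proof -
  have lam_pos: "0 < lam i" for i
    using pos_def_conjugate_Diag[OF assms(3)] assms(1,4) by blast
  \<comment> \<open>All \<open>CARD('n)\<close> distinct eigenvalues occur among the values of
    \<open>lam\<close>, so \<open>lam\<close> is injective by counting.\<close>
  have "CARD('n) \<le> card (range lam)"
    using card_mono[OF _ eigenvalues_conjugate_Diag[OF assms(3), of lam]] assms(2,4) by simp
  then have lam_inj: "inj lam"
    by (intro eq_card_imp_inj_on) (simp_all add: card_image_le antisym)
  interpret bures_wasserstein_target \<Omega> lam
    by unfold_locales (use assms(3) lam_pos lam_inj in auto)
  have Sig: "\<Sigma> = Sig" unfolding Sig_def by (rule assms(4))
  have nth_bij: "bij_betw (nth_index J :: 'k::{finite,linorder} \<Rightarrow> 'n) UNIV J" if "card J = k" for J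
    using bij_betw_nth_index that assms(6) by simp
  then have nth_inj: "inj (nth_index J :: 'k::{finite,linorder} \<Rightarrow> 'n)" and nth_range: "range (nth_index J :: 'k::{finite,linorder} \<Rightarrow> 'n) = J"
    if "card J = k" for J
    using that by (auto simp: bij_betw_def)
  have crit_eq: "crit J V = select_columns \<Omega> (nth_index J) ** Diag (\<lambda>a. sqrt (lam (nth_index J a))) ** transpose V"
    if "card J = k" for J V
  proof -
    have "principal_submatrix (Diag lam) J = Diag (\<lambda>a::'k::{finite,linorder}. lam (nth_index J a))"
      using nth_inj[OF that] by (simp add: principal_submatrix_def Diag_def vec_eq_iff inj_eq)
    then show ?thesis
      using lam_pos by (simp add: crit_def psd_sqrt_Diag less_imp_le col_submatrix_def select_columns_def)
  qed
  have crit_rank: "crit J V \<in> rank_eq k"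
    and crit_crit: "critical_point_on L (rank_eq k) (crit J V)"
    and crit_value: "L (crit J V) = trace Sig - (\<Sum>i\<in>J. lam i)"
    if J: "card J = k" and V: "transpose V ** V = mat 1" for J V
    using select_columns_critical[OF nth_inj[OF J] V] assms(6)
      sum.reindex_bij_betw[OF nth_bij[OF J], of lam]
    by (simp_all add: crit_eq[OF J] rank_eq_def L_def Sig)
  have gram: "\<exists>V. transpose V ** V = mat 1 \<and> W = crit J V"
    if "card J = k" "W ** transpose W = \<Omega> ** Diag (\<lambda>i. if i \<in> J then lam i else 0) ** transpose \<Omega>" for J W
    using gram_determines_factor[OF nth_inj[OF that(1)], of W] that(2) nth_range[OF that(1)] crit_eq[OF that(1)] by metis
  have first: "(\<forall>W\<in>rank_eq k. critical_point_on L (rank_eq k) W \<longleftrightarrow>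
            (\<exists>J V. card J = k \<and> transpose V ** V = mat 1 \<and> W = crit J V))"
  proof (intro ballI iffI)
    fix W assume "critical_point_on L (rank_eq k) W"
    then obtain J where "card J = k" "W ** transpose W = \<Omega> ** Diag (\<lambda>i. if i \<in> J then lam i else 0) ** transpose \<Omega>"
      unfolding L_def Sig by (rule critical_point_gram)
    then show "\<exists>J V. card J = k \<and> transpose V ** V = mat 1 \<and> W = crit J V" using gram by blast
  qed (use crit_crit in blast)
  define F :: "'n::{finite,linorder} set" where "F = first_indices k"
  have cF: "card F = k" unfolding F_def using assms(7) by (intro card_first_indices) simp
  \<comment> \<open>Monotonicity gives the weak inequality; distinctness makes it strict, as the
    equality case needs.\<close>
  have top: "lam j < lam i" if "i \<in> F" "j \<notin> F" for i j
  proof -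
    have "i < j" using first_indices_less that unfolding F_def by blast
    then have "lam j \<le> lam i" "lam j \<noteq> lam i" using assms(5) lam_inj by (auto simp: antimono_def inj_eq)
    then show ?thesis by simp
  qed
  have lower: "trace Sig - (\<Sum>i\<in>F. lam i) \<le> L W" if "W \<in> rank_le k" for W
    using bw_loss_rank_le(1)[of W F] top that cF by (simp add: L_def Sig rank_le_def)
  obtain V0 :: "real ^ 'k::{finite,linorder} ^ 'm" where V0: "transpose V0 ** V0 = mat 1"
    using orthonormal_columns_exist[where 'k='k and 'm='m] assms(6,7) by auto
  have sub: "rank_eq k \<subseteq> (rank_le k :: (real ^ 'm ^ 'n::{finite,linorder}) set)" by (auto simp: rank_eq_def rank_le_def)
  \<comment> \<open>The bound \<open>lower\<close> is attained at \<open>crit F V0\<close>, so being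
    a minimizer means attaining exactly this value.\<close>
  have arg_min: "is_arg_min L (\<lambda>W. W \<in> rank_le k) W \<longleftrightarrow> W \<in> rank_le k \<and> L W = trace Sig - (\<Sum>i\<in>F. lam i)" for W
  proof
    assume am: "is_arg_min L (\<lambda>W. W \<in> rank_le k) W"
    then have "W \<in> rank_le k" "L W \<le> L (crit F V0)"
      using crit_rank[OF cF V0] sub by (auto simp: is_arg_min_def not_less)
    then show "W \<in> rank_le k \<and> L W = trace Sig - (\<Sum>i\<in>F. lam i)"
      using lower[of W] crit_value[OF cF V0] by simp
  qed (use lower in \<open>force simp: is_arg_min_def not_less\<close>)
  have second: "{W. is_arg_min L (\<lambda>W. W \<in> rank_le k) W} = {crit F V |V. transpose V ** V = mat 1}"
  proof (intro equalityI subsetI)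
    fix W assume "W \<in> {W. is_arg_min L (\<lambda>W. W \<in> rank_le k) W}"
    then have "W \<in> rank_le k" "L W = trace Sig - (\<Sum>i\<in>F. lam i)" using arg_min by auto
    then have "W ** transpose W = \<Omega> ** Diag (\<lambda>i. if i \<in> F then lam i else 0) ** transpose \<Omega>"
      using bw_loss_rank_le(2)[of W F] top cF by (simp add: L_def Sig rank_le_def)
    from gram[OF cF this] show "W \<in> {crit F V |V. transpose V ** V = mat 1}" by blast
  next
    fix W assume "W \<in> {crit F V |V. transpose V ** V = mat 1}"
    then obtain V where V: "transpose V ** V = mat 1" "W = crit F V" by blast
    then show "W \<in> {W. is_arg_min L (\<lambda>W. W \<in> rank_le k) W}"
      using arg_min crit_rank[OF cF V(1)] crit_value[OF cF V(1)] sub by auto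
  qed
  define W0 where "W0 = crit F V0"
  have W0: "W0 \<in> rank_eq k" "L W0 = trace Sig - (\<Sum>i\<in>F. lam i)"
    using crit_rank[OF cF V0] crit_value[OF cF V0] by (auto simp: W0_def)
  have "is_arg_min L (\<lambda>W. W \<in> rank_eq k) W0" "is_arg_min L (\<lambda>W. W \<in> rank_le k) W0"
    using W0 lower sub by (force simp: is_arg_min_def not_less)+
  moreover have "(INF W\<in>rank_eq k. L W) = L W0"
    by (rule cInf_eq_minimum) (use W0 lower sub in force)+
  ultimately show ?thesis using first second unfolding F_def by blast
qed

end
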